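(* For every $k\ge1$ there are constants $c,c'>0$ such that the following holds. Let $n\ge 2k$, and suppose that $w_1,\ldots,w_{k+1}:[n]^{(k)}\to\mathbb{R}$ are weighted $k$-uniform hypergraphs on $[n]$ such that $w_i([n])=0$ and $\|w_i\|_1=\binom nk$ for every $i$. Then there are distinct $i$ and $j$ such that $$\operatorname{disc}^+(w_i,w_j)\operatorname{disc}^-(w_i,w_j)\ge cn^{k+1}.$$ In particular, there are $i<j$ such that $\operatorname{disc}(w_i,w_j)\ge c'n^{(k+1)/2}$.
   Context: $[n]=\{1,\ldots,n\}$ and $V^{(k)}$ denotes the family of $k$-element subsets of $V$. A weighted $k$-uniform hypergraph on $V$ is a function $w:V^{(k)}\to\mathbb{R}$; $w(S)=\sum_{e\in S^{(k)}}w(e)$, $\|w\|_1=\sum_{e}|w(e)|$, $\langle w,u\rangle=\sum_{e\in V^{(k)}}w(e)u(e)$, and $d(w)=w(V)/\binom{|V|}{k}$. For a permutation $\pi$ of $V$, $w_\pi(e)=w(\pi^{-1}(e))$. With $n=|V|$, $\operatorname{disc}^+(w,u)=\max_\pi\langle w_\pi,u\rangle-d(w)d(u)\binom nk$, $\operatorname{disc}^-(w,u)=d(w)d(u)\binom nk-\min_\pi\langle w_\pi,u\rangle$ (over all permutations $\pi$ of $V$), and $\operatorname{disc}(w,u)=\max\{\operatorname{disc}^+(w,u),\operatorname{disc}^-(w,u)\}$. *)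

theory Defs
  imports "HOL-Analysis.Analysis" "HOL-Combinatorics.Permutations"
begin

text \<open>Weighted k-uniform hypergraphs on a finite vertex set V are functions
  w :: 'a set \<Rightarrow> real; only their values on the k-subsets of V matter.\<close>

definition ksubsets :: "'a set \<Rightarrow> nat \<Rightarrow> 'a set set" where
  "ksubsets V k = {e. e \<subseteq> V \<and> card e = k}"

definition hweight :: "nat \<Rightarrow> ('a set \<Rightarrow> real) \<Rightarrow> 'a set \<Rightarrow> real" where
  "hweight k w S = (\<Sum>e\<in>ksubsets S k. w e)"

definition hnorm1 :: "'a set \<Rightarrow> nat \<Rightarrow> ('a set \<Rightarrow> real) \<Rightarrow> real" where
  "hnorm1 V k w = (\<Sum>e\<in>ksubsets V k. \<bar>w e\<bar>)"

definition hinner :: "'a set \<Rightarrow> nat \<Rightarrow> ('a set \<Rightarrow> real) \<Rightarrow> ('a set \<Rightarrow> real) \<Rightarrow> real" where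
  "hinner V k w u = (\<Sum>e\<in>ksubsets V k. w e * u e)"

definition hdensity :: "'a set \<Rightarrow> nat \<Rightarrow> ('a set \<Rightarrow> real) \<Rightarrow> real" where
  "hdensity V k w = hweight k w V / real (card V choose k)"

definition hperm :: "('a \<Rightarrow> 'a) \<Rightarrow> ('a set \<Rightarrow> real) \<Rightarrow> 'a set \<Rightarrow> real" where
  "hperm \<pi> w e = w (inv \<pi> ` e)"

definition disc_plus :: "'a set \<Rightarrow> nat \<Rightarrow> ('a set \<Rightarrow> real) \<Rightarrow> ('a set \<Rightarrow> real) \<Rightarrow> real" where
  "disc_plus V k w u =
     Max {hinner V k (hperm \<pi> w) u | \<pi>. \<pi> permutes V}
     - hdensity V k w * hdensity V k u * real (card V choose k)"

definition disc_minus :: "'a set \<Rightarrow> nat \<Rightarrow> ('a set \<Rightarrow> real) \<Rightarrow> ('a set \<Rightarrow> real) \<Rightarrow> real" where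
  "disc_minus V k w u =
     hdensity V k w * hdensity V k u * real (card V choose k)
     - Min {hinner V k (hperm \<pi> w) u | \<pi>. \<pi> permutes V}"

definition disc :: "'a set \<Rightarrow> nat \<Rightarrow> ('a set \<Rightarrow> real) \<Rightarrow> ('a set \<Rightarrow> real) \<Rightarrow> real" where
  "disc V k w u = max (disc_plus V k w u) (disc_minus V k w u)"

end

theory Submission
  imports Defs
begin

text \<open>Write \<open>X \<pi>\<close> for the overlap of \<open>w\<^sub>\<pi>\<close> and \<open>u\<close>. Alternating sums of \<open>w\<close> over \<open>j\<close> disjoint
  pairs of vertices measure the part of \<open>w\<close> lying in the \<open>j\<close>-th irreducible component of the
  space of functions on \<open>k\<close>-sets. A weighting with total weight 0 has a large alternating sum for
  some \<open>j\<close> between 1 and \<open>k\<close>, so among \<open>k + 1\<close> weightings two share such a \<open>j\<close>.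

  For these two, fix a random placement and disjoint pairs of vertices. Exchanging pairs makes
  \<open>X\<close> a polynomial of degree at most \<open>k\<close> on a discrete cube, whose
  Fourier coefficient at a set of \<open>j\<close> pairs is on average, up to normalisation, at
  least the product of the two alternating sums. Exchange part of the pairs at random: by
  hypercontractivity each linear coefficient in the remaining variables is then typically as
  large as the square sum of the degree \<open>j\<close> coefficients allows. Bias the remaining
  exchanges towards the signs of these coefficients with strength \<open>t\<close>: the
  expectation of \<open>X\<close> is a polynomial in \<open>t\<close> of degree at most
  \<open>k\<close> without constant term, whose slope at 0 has order at least \<open>n\<close>
  to the power \<open>(k + 1) / 2\<close>. The slope of such a polynomial is bounded by the
  geometric mean of its maximum and of minus its minimum on the interval from -1 to 1.\<close>

section \<open>Fourier analysis on the discrete cube\<close>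

text \<open>The obstacle is that the shared order \<open>j\<close> may exceed 1, while only linear
  coefficients enter the slope. The pairs are therefore split into \<open>A\<close> and
  \<open>B\<close>. Once those in \<open>B\<close> are exchanged at random, the linear coefficient
  at a pair \<open>s\<close> of \<open>A\<close> is a function on the cube of \<open>B\<close>, and
  its coefficient at \<open>T\<close> is the original coefficient at \<open>insert s T\<close>. The
  roughly n^(j-1) sets \<open>T\<close> of size j - 1 contribute to the L2 norm of this function,
  and hypercontractivity passes from there to the L1 norm, which is what the slope consists of.

  Count of exponents: alternating norms of order n^(k+j) make a single coefficient of average order
  n^(k-j). Summing over the pairs in \<open>A\<close>, the slope has order n * n^((j-1)/2) * n^(k-j)
  = n^(k+(1-j)/2). The worst case j = k gives the exponent (k+1)/2.\<close>

definition cube_avg :: "'a set \<Rightarrow> ('a set \<Rightarrow> real) \<Rightarrow> real" where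
  "cube_avg I f = (\<Sum>S\<in>Pow I. f S) / 2 ^ card I"

definition walsh :: "'a set \<Rightarrow> 'a set \<Rightarrow> real" where
  "walsh T S = (- 1) ^ card (S \<inter> T)"

definition fourier :: "'a set \<Rightarrow> ('a set \<Rightarrow> real) \<Rightarrow> 'a set \<Rightarrow> real" where
  "fourier I f T = cube_avg I (\<lambda>S. walsh T S * f S)"

lemma sum_Pow_insert:
  assumes "finite I" "s \<notin> I"
  shows "(\<Sum>S\<in>Pow (insert s I). F S) = (\<Sum>S\<in>Pow I. F S) + (\<Sum>S\<in>Pow I. F (insert s S))"
proof -
  have inj: "inj_on (insert s) (Pow I)"
    using assms(2) by (auto simp: inj_on_def)
  have "(\<Sum>S\<in>Pow (insert s I). F S) = (\<Sum>S\<in>Pow I. F S) + (\<Sum>S\<in>insert s ` Pow I. F S)"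
    unfolding Pow_insert using assms by (intro sum.union_disjoint) auto
  then show ?thesis by (simp add: sum.reindex[OF inj])
qed

lemma cube_avg_empty [simp]: "cube_avg {} f = f {}"
  by (simp add: cube_avg_def)

lemma cube_avg_insert:
  assumes "finite I" "s \<notin> I"
  shows "cube_avg (insert s I) f = cube_avg I (\<lambda>S. (f S + f (insert s S)) / 2)"
  using assms by (simp add: cube_avg_def sum_Pow_insert sum.distrib flip: sum_divide_distrib)

lemma cube_avg_cong:
  "(\<And>S. S \<subseteq> I \<Longrightarrow> f S = g S) \<Longrightarrow> cube_avg I f = cube_avg I g"
  by (simp add: cube_avg_def)

lemma cube_avg_add: "cube_avg I (\<lambda>S. f S + g S) = cube_avg I f + cube_avg I g"
  by (simp add: cube_avg_def sum.distrib add_divide_distrib)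

lemma cube_avg_mult: "cube_avg I (\<lambda>S. c * f S) = c * cube_avg I f"
  by (simp add: cube_avg_def sum_distrib_left)

lemma cube_avg_sum: "cube_avg I (\<lambda>S. \<Sum>x\<in>X. f x S) = (\<Sum>x\<in>X. cube_avg I (f x))"
  unfolding cube_avg_def by (subst sum.swap) (simp add: sum_divide_distrib)

lemma cube_avg_const: "finite I \<Longrightarrow> cube_avg I (\<lambda>S. c) = c"
  by (simp add: cube_avg_def card_Pow)

lemma cube_avg_mono:
  "(\<And>S. S \<subseteq> I \<Longrightarrow> f S \<le> g S) \<Longrightarrow> cube_avg I f \<le> cube_avg I g"
  unfolding cube_avg_def by (intro divide_right_mono sum_mono) auto

lemma cube_avg_nonneg: "(\<And>S. S \<subseteq> I \<Longrightarrow> 0 \<le> f S) \<Longrightarrow> 0 \<le> cube_avg I f"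
  unfolding cube_avg_def by (intro divide_nonneg_nonneg sum_nonneg) auto

lemma walsh_insert:
  assumes "finite S" "s \<notin> S"
  shows "walsh T (insert s S) = (if s \<in> T then - walsh T S else walsh T S)"
  using assms by (auto simp: walsh_def Int_insert_left)

lemma walsh_insert_left_absent: "s \<notin> S \<Longrightarrow> walsh (insert s T) S = walsh T S"
  by (simp add: walsh_def Int_insert_right)

lemma walsh_eq_prod:
  assumes "finite T"
  shows "walsh T S = (\<Prod>s\<in>T. if s \<in> S then - 1 else 1)"
  using assms by (simp add: walsh_def prod.If_cases Int_commute)

lemma abs_walsh [simp]: "\<bar>walsh T S\<bar> = 1"
  by (simp add: walsh_def power_abs)

lemma walsh_toggle:
  assumes "finite S" "s \<in> T"
  shows "walsh T (if s \<in> S then S - {s} else insert s S) = - walsh T S"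
proof (cases "s \<in> S")
  case True
  then have "walsh T S = - walsh T (S - {s})"
    using assms walsh_insert[of "S - {s}" s T] by (simp add: insert_absorb)
  then show ?thesis using True by simp
qed (use assms walsh_insert[of S s T] in auto)

lemma sum_toggle:
  assumes "s \<in> I"
  shows "(\<Sum>S\<in>Pow I. F (if s \<in> S then S - {s} else insert s S)) = (\<Sum>S\<in>Pow I. F S)"
proof (rule sum.reindex_bij_witness[where i = "\<lambda>S. if s \<in> S then S - {s} else insert s S"
      and j = "\<lambda>S. if s \<in> S then S - {s} else insert s S"])
qed (use assms in \<open>auto simp: insert_absorb split: if_splits\<close>)

lemma cube_avg_toggle:
  assumes "s \<in> I"
  shows "cube_avg I (\<lambda>S. F (if s \<in> S then S - {s} else insert s S)) = cube_avg I F"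
  using sum_toggle[OF assms, of F] by (simp add: cube_avg_def)

lemma fourier_sum: "fourier I (\<lambda>S. \<Sum>x\<in>X. f x S) T = (\<Sum>x\<in>X. fourier I (f x) T)"
  by (simp add: fourier_def sum_distrib_left cube_avg_sum)

text \<open>Toggling \<open>s\<close> permutes the cube, preserves \<open>f\<close> and negates the
  Walsh function, so the coefficient equals its own negative.\<close>

lemma fourier_eq_0:
  assumes "finite I" "s \<in> I" "s \<in> T"
    and inv: "\<And>S. S \<subseteq> I \<Longrightarrow> f (if s \<in> S then S - {s} else insert s S) = f S"
  shows "fourier I f T = 0"
proof -
  have "fourier I f T = cube_avg I (\<lambda>S. walsh T (if s \<in> S then S - {s} else insert s S)
      * f (if s \<in> S then S - {s} else insert s S))"
    unfolding fourier_def using cube_avg_toggle[OF assms(2), of "\<lambda>S. walsh T S * f S"] by simp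
  also have "\<dots> = cube_avg I (\<lambda>S. - 1 * (walsh T S * f S))"
    by (rule cube_avg_cong)
      (metis assms(1,3) finite_subset inv mult_minus_left mult_1 walsh_toggle)
  also have "\<dots> = - fourier I f T"
    unfolding cube_avg_mult fourier_def by simp
  finally show ?thesis by simp
qed

text \<open>Splitting off the coordinate \<open>s\<close> writes \<open>f\<close> as an even part
  (half sum) plus the Walsh function of \<open>s\<close> times an odd part (half difference).
  Coefficients at sets without \<open>s\<close> belong to the even part, those at sets with
  \<open>s\<close> to the odd part; the inductions on the cube rest on this.\<close>

lemma fourier_insert_absent:
  assumes "finite I" "s \<notin> I" "s \<notin> T"
  shows "fourier (insert s I) f T = fourier I (\<lambda>S. (f S + f (insert s S)) / 2) T"
  unfolding fourier_def cube_avg_insert[OF assms(1,2)]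
proof (rule cube_avg_cong)
  fix S assume "S \<subseteq> I"
  then have "finite S" "s \<notin> S" using assms finite_subset by auto
  then show "(walsh T S * f S + walsh T (insert s S) * f (insert s S)) / 2
      = walsh T S * ((f S + f (insert s S)) / 2)"
    using assms by (simp add: walsh_insert algebra_simps)
qed

lemma fourier_insert_present:
  assumes "finite I" "s \<notin> I"
  shows "fourier (insert s I) f (insert s T) = fourier I (\<lambda>S. (f S - f (insert s S)) / 2) T"
  unfolding fourier_def cube_avg_insert[OF assms(1,2)]
proof (rule cube_avg_cong)
  fix S assume "S \<subseteq> I"
  then have "finite S" "s \<notin> S" using assms finite_subset by auto
  then show "(walsh (insert s T) S * f S + walsh (insert s T) (insert s S) * f (insert s S)) / 2
      = walsh T S * ((f S - f (insert s S)) / 2)"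
    by (simp add: walsh_insert walsh_insert_left_absent algebra_simps)
qed

section \<open>Parseval's identity and hypercontractivity\<close>

lemma cube_parseval:
  assumes "finite I"
  shows "cube_avg I (\<lambda>S. (f S)\<^sup>2) = (\<Sum>T\<in>Pow I. (fourier I f T)\<^sup>2)"
  using assms
proof (induction I arbitrary: f rule: finite_induct)
  case empty
  then show ?case by (simp add: fourier_def walsh_def)
next
  case (insert s I)
  let ?g = "\<lambda>S. (f S + f (insert s S)) / 2" and ?h = "\<lambda>S. (f S - f (insert s S)) / 2"
  have "cube_avg (insert s I) (\<lambda>S. (f S)\<^sup>2) = cube_avg I (\<lambda>S. (?g S)\<^sup>2 + (?h S)\<^sup>2)"
    unfolding cube_avg_insert[OF insert.hyps]
    by (rule cube_avg_cong) (simp add: power2_eq_square field_simps)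
  also have "\<dots> = (\<Sum>T\<in>Pow I. (fourier I ?g T)\<^sup>2) + (\<Sum>T\<in>Pow I. (fourier I ?h T)\<^sup>2)"
    unfolding cube_avg_add insert.IH ..
  also have "\<dots> = (\<Sum>T\<in>Pow (insert s I). (fourier (insert s I) f T)\<^sup>2)"
    unfolding sum_Pow_insert[OF insert.hyps] fourier_insert_present[OF insert.hyps]
    by (intro arg_cong2[where f = "(+)"] sum.cong refl)
      (metis fourier_insert_absent[OF insert.hyps] insert.hyps(2) PowD subsetD)
  finally show ?case .
qed

lemma cube_Cauchy_Schwarz:
  "(cube_avg I (\<lambda>S. f S * g S))\<^sup>2 \<le> cube_avg I (\<lambda>S. (f S)\<^sup>2) * cube_avg I (\<lambda>S. (g S)\<^sup>2)"
  using Cauchy_Schwarz_ineq_sum[of f g "Pow I"]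
  by (simp add: cube_avg_def power_divide divide_right_mono flip: power2_eq_square)

text \<open>Bonami's lemma. The odd part \<open>h\<close> has degree one less than \<open>f\<close>,
  since its coefficients are those of \<open>f\<close> at sets containing the extra coordinate. Odd
  powers cancel when the two values of \<open>f\<close> are averaged, which leaves the fourth
  moments of \<open>g\<close> and \<open>h\<close> and one mixed term.\<close>

lemma cube_bonami:
  assumes "finite I" "\<And>T. T \<subseteq> I \<Longrightarrow> d < card T \<Longrightarrow> fourier I f T = 0"
  shows "cube_avg I (\<lambda>S. f S ^ 4) \<le> 9 ^ d * (cube_avg I (\<lambda>S. (f S)\<^sup>2))\<^sup>2"
  using assms
proof (induction I arbitrary: f d rule: finite_induct)
  case empty
  have "f {} ^ 4 * 1 \<le> f {} ^ 4 * 9 ^ d"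
    by (intro mult_left_mono) auto
  then show ?case by (simp add: mult.commute flip: power_mult)
next
  case (insert s I)
  define g where "g = (\<lambda>S. (f S + f (insert s S)) / 2)"
  define h where "h = (\<lambda>S. (f S - f (insert s S)) / 2)"
  have fin: "finite T" if "T \<subseteq> I" for T
    using that insert.hyps finite_subset by auto
  have g0: "fourier I g T = 0" if "T \<subseteq> I" "d < card T" for T
  proof -
    have "s \<notin> T" "T \<subseteq> insert s I"
      using that insert.hyps by auto
    then show ?thesis
      using insert.prems[of T] that(2) unfolding g_def
      by (simp add: fourier_insert_absent[OF insert.hyps])
  qed
  have h1: "fourier I h T = 0" if "T \<subseteq> I" "d < Suc (card T)" for T
  proof -
    have "card (insert s T) = Suc (card T)"
      using that insert.hyps fin by (metis card_insert_disjoint subsetD)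
    then show ?thesis
      using that insert.prems[of "insert s T"] insert.hyps fourier_insert_present[of I s f T]
      unfolding h_def by auto
  qed
  define G2 where "G2 = cube_avg I (\<lambda>S. (g S)\<^sup>2)"
  define H2 where "H2 = cube_avg I (\<lambda>S. (h S)\<^sup>2)"
  define G4 where "G4 = cube_avg I (\<lambda>S. g S ^ 4)"
  define H4 where "H4 = cube_avg I (\<lambda>S. h S ^ 4)"
  define GH where "GH = cube_avg I (\<lambda>S. (g S)\<^sup>2 * (h S)\<^sup>2)"
  have nonneg: "G2 \<ge> 0" "H2 \<ge> 0" "GH \<ge> 0" "G4 \<ge> 0" "H4 \<ge> 0"
    by (auto simp: G2_def H2_def GH_def G4_def H4_def intro!: cube_avg_nonneg)
  have f2: "cube_avg (insert s I) (\<lambda>S. (f S)\<^sup>2) = G2 + H2"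
    unfolding cube_avg_insert[OF insert.hyps] G2_def H2_def cube_avg_add[symmetric] g_def h_def
    by (rule cube_avg_cong) (simp add: power2_eq_square field_simps)
  have f4: "cube_avg (insert s I) (\<lambda>S. f S ^ 4) = G4 + 6 * GH + H4"
    unfolding cube_avg_insert[OF insert.hyps] G4_def H4_def GH_def cube_avg_mult[symmetric]
      cube_avg_add[symmetric] g_def h_def
    by (rule cube_avg_cong) (simp add: power2_eq_square power4_eq_xxxx field_simps)
  have G4: "G4 \<le> 9 ^ d * G2\<^sup>2"
    unfolding G4_def G2_def using g0 by (rule insert.IH)
  have GH: "GH\<^sup>2 \<le> G4 * H4"
    using cube_Cauchy_Schwarz[of I "\<lambda>S. (g S)\<^sup>2" "\<lambda>S. (h S)\<^sup>2"]
    by (simp add: GH_def G4_def H4_def)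
  have "G4 + 6 * GH + H4 \<le> 9 ^ d * (G2 + H2)\<^sup>2"
  proof (cases d)
    \<comment> \<open>In degree 0 all coefficients of \<open>h\<close> vanish, so \<open>h\<close>
      is 0 and only \<open>g\<close> remains.\<close>
    case 0
    have "H2 = (\<Sum>T\<in>Pow I. (fourier I h T)\<^sup>2)"
      unfolding H2_def by (rule cube_parseval[OF insert.hyps(1)])
    also have "\<dots> = 0"
      using h1 0 by (intro sum.neutral) auto
    finally have H2: "H2 = 0" .
    then have "\<And>S. S \<in> Pow I \<Longrightarrow> (h S)\<^sup>2 = 0"
      unfolding H2_def cube_avg_def using insert.hyps(1) sum_nonneg_eq_0_iff[of "Pow I" "\<lambda>S. (h S)\<^sup>2"]
      by simp
    then have "H4 = 0"
      unfolding H4_def cube_avg_def by simp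
    then show ?thesis using GH G4 H2 by simp
  next
    case (Suc e)
    have H4: "H4 \<le> 9 ^ e * H2\<^sup>2"
      unfolding H4_def H2_def by (rule insert.IH) (use h1 Suc in auto)
    have "GH\<^sup>2 \<le> (9 ^ d * G2\<^sup>2) * (9 ^ e * H2\<^sup>2)"
      using GH mult_mono[OF G4 H4] nonneg by simp
    also have "\<dots> = (3 * 9 ^ e * (G2 * H2))\<^sup>2"
      by (simp add: Suc power_mult_distrib power2_eq_square)
    \<comment> \<open>Hence 6 * GH is at most 18 * 9^e * G2 * H2 = 2 * 9^d * G2 * H2, exactly the
      cross term of the square. This is the origin of the constant 9.\<close>
    finally have "GH \<le> 3 * 9 ^ e * (G2 * H2)"
      by (rule power2_le_imp_le) (use nonneg in simp)
    then have "6 * GH \<le> 9 ^ e * (18 * (G2 * H2))" by (simp add: mult_ac)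
    moreover have "9 ^ e * H2\<^sup>2 \<le> 9 ^ d * H2\<^sup>2"
      by (intro mult_right_mono) (auto simp: Suc)
    ultimately have "G4 + 6 * GH + H4 \<le> 9 ^ d * G2\<^sup>2 + 9 ^ e * (18 * (G2 * H2)) + 9 ^ d * H2\<^sup>2"
      using G4 H4 by linarith
    also have "\<dots> = 9 ^ d * (G2 + H2)\<^sup>2"
      by (simp add: Suc power2_eq_square algebra_simps)
    finally show ?thesis .
  qed
  then show ?case unfolding f2 f4 .
qed

text \<open>A polynomial of bounded degree cannot be concentrated on a small part of the cube: its
  fourth moment is controlled by its second, which forces the first moment up to the order of the L2
  norm.\<close>

lemma cube_L1_ge_L2:
  assumes "finite I" "\<And>T. T \<subseteq> I \<Longrightarrow> d < card T \<Longrightarrow> fourier I f T = 0"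
  shows "sqrt (cube_avg I (\<lambda>S. (f S)\<^sup>2)) / (2 * 3 ^ d) \<le> cube_avg I (\<lambda>S. \<bar>f S\<bar>)"
proof (cases "cube_avg I (\<lambda>S. (f S)\<^sup>2) = 0")
  case True
  then show ?thesis by (simp add: cube_avg_nonneg)
next
  case False
  define v where "v = cube_avg I (\<lambda>S. (f S)\<^sup>2)"
  have "v \<ge> 0" by (auto simp: v_def intro!: cube_avg_nonneg)
  with False have "v > 0" by (simp add: v_def)
  \<comment> \<open>At this scale the fourth moment is at most v * c^2. The minorant, applied to the
    absolute value of f divided by c and multiplied by c, then gives at least v / c - v / (6 *
    c).\<close>
  define c where "c = sqrt v * 3 ^ d"
  have c: "c > 0" "c\<^sup>2 = v * 9 ^ d"
  proof -
    have "(3 ^ d)\<^sup>2 = (9::real) ^ d"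
      by (simp add: power2_eq_square flip: power_mult_distrib)
    then show "c > 0" "c\<^sup>2 = v * 9 ^ d"
      using \<open>v > 0\<close> by (simp_all add: c_def power_mult_distrib)
  qed
  \<comment> \<open>The quartic minorant r^2 - r^4/6 of r turns the moment bound into a bound on the first moment.\<close>
  have minorant: "r\<^sup>2 - r ^ 4 / 6 \<le> r" if "r \<ge> 0" for r :: real
  proof -
    have "r * (r - r ^ 3 / 6) \<le> r * 1"
    proof (rule mult_left_mono[OF _ that])
      \<comment> \<open>The cubic with double root 3/2 says that r - 1 is at most 4 r^3 / 27, and
        4/27 < 1/6.\<close>
      have "0 \<le> (r - 3 / 2)\<^sup>2 * (r + 3)" "0 \<le> r ^ 3"
        using that by simp_all
      moreover have "(r - 3 / 2)\<^sup>2 * (r + 3) = r ^ 3 - 27 / 4 * r + 27 / 4"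
        by (simp add: power2_eq_square power3_eq_cube algebra_simps)
      ultimately show "r - r ^ 3 / 6 \<le> 1" by linarith
    qed
    then show ?thesis by (simp add: power2_eq_square power3_eq_cube power4_eq_xxxx algebra_simps)
  qed
  have "(1 / c) * (f S)\<^sup>2 + (- 1 / (6 * c ^ 3)) * f S ^ 4 \<le> \<bar>f S\<bar>" for S
  proof -
    have "c * ((\<bar>f S\<bar> / c)\<^sup>2 - (\<bar>f S\<bar> / c) ^ 4 / 6) \<le> c * (\<bar>f S\<bar> / c)"
      using c(1) by (intro mult_left_mono minorant) auto
    moreover have "c * ((\<bar>f S\<bar> / c)\<^sup>2 - (\<bar>f S\<bar> / c) ^ 4 / 6)
        = (1 / c) * (f S)\<^sup>2 + (- 1 / (6 * c ^ 3)) * f S ^ 4"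
      using c(1) by (simp add: power_divide right_diff_distrib power2_eq_square power3_eq_cube power4_eq_xxxx)
    ultimately show ?thesis using c(1) by simp
  qed
  then have "cube_avg I (\<lambda>S. (1 / c) * (f S)\<^sup>2 + (- 1 / (6 * c ^ 3)) * f S ^ 4) \<le> cube_avg I (\<lambda>S. \<bar>f S\<bar>)"
    by (intro cube_avg_mono)
  then have "v / c - cube_avg I (\<lambda>S. f S ^ 4) / (6 * c ^ 3) \<le> cube_avg I (\<lambda>S. \<bar>f S\<bar>)"
    unfolding cube_avg_add cube_avg_mult v_def by simp
  moreover have "cube_avg I (\<lambda>S. f S ^ 4) / (6 * c ^ 3) \<le> v / (6 * c)"
  proof -
    have "cube_avg I (\<lambda>S. f S ^ 4) \<le> v * c\<^sup>2"
      using cube_bonami[OF assms] c by (simp add: v_def power2_eq_square mult_ac)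
    then have "cube_avg I (\<lambda>S. f S ^ 4) / (6 * c ^ 3) \<le> v * c\<^sup>2 / (6 * c ^ 3)"
      using c by (intro divide_right_mono) auto
    then show ?thesis using c(1) by (simp add: power2_eq_square power3_eq_cube)
  qed
  moreover have "v / c - v / (6 * c) \<ge> v / (2 * c)"
    using c(1) \<open>v > 0\<close> by (simp add: field_simps)
  moreover have "v / (2 * c) = sqrt v / (2 * 3 ^ d)"
    using \<open>v > 0\<close> real_sqrt_mult_self[of v] by (simp add: c_def field_simps)
  ultimately show ?thesis by (simp add: v_def)
qed

text \<open>By Parseval, M coefficients of size x force an L2 norm of at least sqrt M * x, hence a
  first moment of that order. So the absolute sum M * x exceeds the first moment by a factor of
  order sqrt M at most.\<close>

lemma cube_L1_ge_fourier:
  assumes "finite I" "\<And>T. T \<subseteq> I \<Longrightarrow> d < card T \<Longrightarrow> fourier I f T = 0" and "X \<subseteq> Pow I"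
  shows "(\<Sum>T\<in>X. \<bar>fourier I f T\<bar>) \<le> 2 * 3 ^ d * sqrt (card X) * cube_avg I (\<lambda>S. \<bar>f S\<bar>)"
proof -
  have "(\<Sum>T\<in>X. 1 * \<bar>fourier I f T\<bar>)\<^sup>2 \<le> (\<Sum>T\<in>X. 1\<^sup>2) * (\<Sum>T\<in>X. \<bar>fourier I f T\<bar>\<^sup>2)"
    by (rule Cauchy_Schwarz_ineq_sum)
  also have "\<dots> \<le> card X * cube_avg I (\<lambda>S. (f S)\<^sup>2)"
    unfolding cube_parseval[OF assms(1)]
    using assms by (auto intro!: mult_left_mono sum_mono2)
  finally have "(\<Sum>T\<in>X. \<bar>fourier I f T\<bar>) \<le> sqrt (card X) * sqrt (cube_avg I (\<lambda>S. (f S)\<^sup>2))"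
    by (simp add: real_le_rsqrt flip: real_sqrt_mult)
  also have "\<dots> \<le> sqrt (card X) * (2 * 3 ^ d * cube_avg I (\<lambda>S. \<bar>f S\<bar>))"
    using cube_L1_ge_L2[OF assms(1,2)] by (intro mult_left_mono) (auto simp: field_simps)
  finally show ?thesis by (simp add: mult_ac)
qed

section \<open>Restriction to subcubes and biased measures\<close>

lemma sum_Pow_Un:
  assumes "A \<inter> B = {}"
  shows "(\<Sum>S\<in>Pow (A \<union> B). F S) = (\<Sum>R\<in>Pow B. \<Sum>S\<in>Pow A. F (R \<union> S))"
  unfolding sum.cartesian_product
  by (rule sum.reindex_bij_witness[where i = "\<lambda>(R, S). R \<union> S" and j = "\<lambda>S. (S \<inter> B, S \<inter> A)"])
    (use assms in \<open>auto intro: arg_cong[where f = F]\<close>)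

text \<open>A coefficient can be taken in two stages: the coefficient at \<open>T\<close> in the
  variables of \<open>A\<close> is a function of the configuration \<open>R\<close> on
  \<open>B\<close>, and its own coefficients are the joint ones.\<close>

lemma fourier_Un:
  assumes fin: "finite A" "finite B" and disj: "A \<inter> B = {}" and "T \<subseteq> A" "U \<subseteq> B"
  shows "fourier B (\<lambda>R. fourier A (\<lambda>S. f (R \<union> S)) T) U = fourier (A \<union> B) f (T \<union> U)"
proof -
  have "walsh (T \<union> U) (R \<union> S) = walsh U R * walsh T S" if "R \<subseteq> B" "S \<subseteq> A" for R S
  proof -
    have "(R \<union> S) \<inter> (T \<union> U) = (R \<inter> U) \<union> (S \<inter> T)"
      using assms that by auto
    moreover have "card ((R \<inter> U) \<union> (S \<inter> T)) = card (R \<inter> U) + card (S \<inter> T)"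
      using assms that finite_subset by (intro card_Un_disjoint) blast+
    ultimately show ?thesis by (simp add: walsh_def power_add)
  qed
  then show ?thesis
    unfolding fourier_def cube_avg_def sum_Pow_Un[OF disj] card_Un_disjoint[OF fin disj]
    by (simp add: power_add sum_distrib_left sum_divide_distrib mult_ac)
qed

text \<open>The product is the density, relative to the uniform measure, of independent signs
  \<open>walsh {s} S\<close> with means \<open>t * \<sigma> s\<close>. It is a probability density
  when these means are at most 1 in absolute value.\<close>

definition biased_avg :: "'a set \<Rightarrow> ('a \<Rightarrow> real) \<Rightarrow> real \<Rightarrow> ('a set \<Rightarrow> real) \<Rightarrow> real" where
  "biased_avg I \<sigma> t f = cube_avg I (\<lambda>S. (\<Prod>s\<in>I. 1 + t * \<sigma> s * walsh {s} S) * f S)"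

lemma biased_avg_fourier:
  assumes "finite I"
  shows "biased_avg I \<sigma> t f = (\<Sum>T\<in>Pow I. t ^ card T * (\<Prod>s\<in>T. \<sigma> s) * fourier I f T)"
proof -
  have "(\<Prod>s\<in>I. 1 + t * \<sigma> s * walsh {s} S) * f S
      = (\<Sum>T\<in>Pow I. t ^ card T * (\<Prod>s\<in>T. \<sigma> s) * (walsh T S * f S))" for S
  proof -
    have "walsh T S = (\<Prod>s\<in>T. walsh {s} S)" if "T \<subseteq> I" for T
      using that assms finite_subset
      by (subst walsh_eq_prod) (auto simp: walsh_def intro!: prod.cong)
    then show ?thesis
      unfolding add.commute[of 1] prod_add[OF assms] sum_distrib_right
      by (intro sum.cong) (auto simp: prod.distrib)
  qed
  then show ?thesis
    unfolding biased_avg_def fourier_def by (simp add: cube_avg_sum cube_avg_mult)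
qed

lemma biased_avg_bounds:
  assumes "finite I" "\<bar>t\<bar> \<le> 1" "\<And>s. s \<in> I \<Longrightarrow> \<bar>\<sigma> s\<bar> \<le> 1"
    and f: "\<And>S. S \<subseteq> I \<Longrightarrow> - a \<le> f S \<and> f S \<le> b"
  shows "- a \<le> biased_avg I \<sigma> t f \<and> biased_avg I \<sigma> t f \<le> b"
proof -
  have nonneg: "0 \<le> (\<Prod>s\<in>I. 1 + t * \<sigma> s * walsh {s} S)" for S
  proof (rule prod_nonneg)
    fix s assume "s \<in> I"
    then have "\<bar>t * \<sigma> s * walsh {s} S\<bar> \<le> 1"
      using assms by (simp add: abs_mult mult_le_one)
    then show "0 \<le> 1 + t * \<sigma> s * walsh {s} S" by linarith
  qed
  \<comment> \<open>The density has total mass 1: a constant function has no coefficient except at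
    the empty set.\<close>
  have const: "biased_avg I \<sigma> t (\<lambda>S. c) = c" for c
  proof -
    have "biased_avg I \<sigma> t (\<lambda>S. c)
        = (\<Sum>T\<in>Pow I. if T = {} then c else 0)"
      unfolding biased_avg_fourier[OF assms(1)]
    proof (intro sum.cong refl)
      fix T assume T: "T \<in> Pow I"
      show "t ^ card T * prod \<sigma> T * fourier I (\<lambda>S. c) T = (if T = {} then c else 0)"
      proof (cases "T = {}")
        case True
        then show ?thesis using assms(1) by (simp add: fourier_def walsh_def cube_avg_const)
      next
        case False
        then obtain s where "s \<in> T" by auto
        then show ?thesis using T assms(1) fourier_eq_0[of I s T "\<lambda>S. c"] by auto
      qed
    qed
    then show ?thesis using assms(1) by simp
  qed
  have "biased_avg I \<sigma> t (\<lambda>S. - a) \<le> biased_avg I \<sigma> t f" "biased_avg I \<sigma> t f \<le> biased_avg I \<sigma> t (\<lambda>S. b)"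
    unfolding biased_avg_def using f nonneg by (intro cube_avg_mono mult_left_mono; blast)+
  then show ?thesis by (simp add: const)
qed

section \<open>The range of a polynomial of bounded degree\<close>

text \<open>On the finite-dimensional space of polynomials of degree at most k the supremum over
  [-1, 1] is a norm, so it bounds every coefficient. The induction on k eliminates the leading
  coefficient.\<close>

lemma poly_coeff_bound:
  "\<exists>C\<ge>1. \<forall>(c :: nat \<Rightarrow> real) M. (\<forall>t. \<bar>t\<bar> \<le> 1 \<longrightarrow> \<bar>\<Sum>i\<le>k. c i * t ^ i\<bar> \<le> M) \<longrightarrow> (\<forall>i\<le>k. \<bar>c i\<bar> \<le> C * M)"
proof (induction k)
  case 0
  show ?case by (intro exI[of _ 1]) (auto dest!: spec[of _ "0::real"])
next
  case (Suc k)
  then obtain C where "C \<ge> 1" and C: "\<And>(c :: nat \<Rightarrow> real) M i. (\<And>t. \<bar>t\<bar> \<le> 1 \<Longrightarrow> \<bar>\<Sum>i\<le>k. c i * t ^ i\<bar> \<le> M) \<Longrightarrow> i \<le> k \<Longrightarrow> \<bar>c i\<bar> \<le> C * M"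
    by metis
  define D where "D = C * (2 ^ Suc k + 1)"
  have "D \<ge> 1 * (0 + 1)" unfolding D_def using \<open>C \<ge> 1\<close> by (intro mult_mono) auto
  then have D: "D \<ge> 1" by simp
  show ?case
  proof (intro exI[of _ "1 + real (Suc k) * D"] conjI allI impI)
    show "1 \<le> 1 + real (Suc k) * D" using D by simp
  next
    fix c :: "nat \<Rightarrow> real" and M i
    assume M: "\<forall>t. \<bar>t\<bar> \<le> 1 \<longrightarrow> \<bar>\<Sum>i\<le>Suc k. c i * t ^ i\<bar> \<le> M" and i: "i \<le> Suc k"
    have "M \<ge> 0" using M[rule_format, of 0] by linarith
    \<comment> \<open>The combination 2^(k+1) q(t/2) - q(t) has lost the leading coefficient of q.\<close>
    have low: "\<bar>c i\<bar> \<le> D * M" if "i \<le> k" for i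
    proof -
      have "\<bar>(2 ^ (Suc k - i) - 1) * c i\<bar> \<le> C * ((2 ^ Suc k + 1) * M)"
      proof (rule C[OF _ that, of "\<lambda>i. (2 ^ (Suc k - i) - 1) * c i"])
        fix t :: real assume t: "\<bar>t\<bar> \<le> 1"
        have "(\<Sum>i\<le>k. (2 ^ (Suc k - i) - 1) * c i * t ^ i)
            = (\<Sum>i\<le>Suc k. (2 ^ (Suc k - i) - 1) * c i * t ^ i)"
          by simp
        also have "\<dots> = (\<Sum>i\<le>Suc k. 2 ^ Suc k * (c i * (t / 2) ^ i) - c i * t ^ i)"
        proof (intro sum.cong refl)
          fix i assume "i \<in> {..Suc k}"
          then have "(2::real) ^ Suc k = 2 ^ (Suc k - i) * 2 ^ i"
            by (simp flip: power_add)
          then show "(2 ^ (Suc k - i) - 1) * c i * t ^ i = 2 ^ Suc k * (c i * (t / 2) ^ i) - c i * t ^ i"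
            by (simp add: power_divide algebra_simps)
        qed
        also have "\<dots> = 2 ^ Suc k * (\<Sum>i\<le>Suc k. c i * (t / 2) ^ i) - (\<Sum>i\<le>Suc k. c i * t ^ i)"
          unfolding sum_subtractf sum_distrib_left ..
        also have "\<bar>\<dots>\<bar> \<le> \<bar>2 ^ Suc k * (\<Sum>i\<le>Suc k. c i * (t / 2) ^ i)\<bar> + \<bar>\<Sum>i\<le>Suc k. c i * t ^ i\<bar>"
          by (rule abs_triangle_ineq4)
        also have "\<dots> \<le> 2 ^ Suc k * M + M"
        proof (rule add_mono)
          show "\<bar>2 ^ Suc k * (\<Sum>i\<le>Suc k. c i * (t / 2) ^ i)\<bar> \<le> 2 ^ Suc k * M"
            unfolding abs_mult using M[rule_format, of "t / 2"] t
            by (simp only: power_abs abs_numeral) (intro mult_left_mono, auto)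
          show "\<bar>\<Sum>i\<le>Suc k. c i * t ^ i\<bar> \<le> M"
            using M[rule_format, of t] t by simp
        qed
        finally show "\<bar>\<Sum>i\<le>k. (2 ^ (Suc k - i) - 1) * c i * t ^ i\<bar> \<le> (2 ^ Suc k + 1) * M"
          by (simp add: algebra_simps)
      qed
      moreover have "\<bar>c i\<bar> \<le> \<bar>(2 ^ (Suc k - i) - 1) * c i\<bar>"
      proof -
        have "(2::real) ^ 1 \<le> 2 ^ (Suc k - i)"
          using that by (intro power_increasing) auto
        then have "1 * \<bar>c i\<bar> \<le> (2 ^ (Suc k - i) - 1) * \<bar>c i\<bar>"
          by (intro mult_right_mono) auto
        then show ?thesis using \<open>(2::real) ^ 1 \<le> _\<close> by (simp add: abs_mult)
      qed
      ultimately show ?thesis by (simp add: D_def mult.assoc)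
    qed
    show "\<bar>c i\<bar> \<le> (1 + real (Suc k) * D) * M"
    proof (cases "i \<le> k")
      case True
      have "D * M \<le> (1 + real (Suc k) * D) * M"
        using \<open>M \<ge> 0\<close> D by (intro mult_right_mono) (auto simp: algebra_simps)
      then show ?thesis using low[OF True] by linarith
    next
      case False
      then have i: "i = Suc k" using i by simp
      \<comment> \<open>The leading coefficient is the value at t = 1 minus the lower
        coefficients.\<close>
      have "\<bar>\<Sum>i\<le>k. c i\<bar> \<le> (\<Sum>i\<le>k. D * M)"
        using low by (intro order_trans[OF sum_abs] sum_mono) auto
      then have "\<bar>\<Sum>i\<le>k. c i\<bar> \<le> real (Suc k) * (D * M)" by simp
      moreover have "\<bar>(\<Sum>i\<le>k. c i) + c (Suc k)\<bar> \<le> M"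
        using M[rule_format, of 1] by simp
      ultimately have "\<bar>c (Suc k)\<bar> \<le> M + real (Suc k) * (D * M)" by linarith
      then show ?thesis by (simp add: i algebra_simps)
    qed
  qed
qed

definition slope_constant :: "nat \<Rightarrow> real \<Rightarrow> bool" where
  "slope_constant k K \<longleftrightarrow> (\<forall>(c :: nat \<Rightarrow> real) a b. c 0 = 0 \<longrightarrow>
     (\<forall>t. \<bar>t\<bar> \<le> 1 \<longrightarrow> - a \<le> (\<Sum>i\<le>k. c i * t ^ i) \<and> (\<Sum>i\<le>k. c i * t ^ i) \<le> b) \<longrightarrow>
     (c 1)\<^sup>2 \<le> K * (a * b))"

text \<open>A function bounded below by - a whose slope at 0 is L must bend by about L^2/a,
  which for a polynomial of bounded degree forces a large value.\<close>

lemma ex_slope_constant: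
  assumes k: "1 \<le> k"
  shows "\<exists>K>0. slope_constant k K"
proof -
  obtain C where "C \<ge> 1" and C: "\<And>(c :: nat \<Rightarrow> real) M i. (\<And>t. \<bar>t\<bar> \<le> 1 \<Longrightarrow> \<bar>\<Sum>i\<le>k. c i * t ^ i\<bar> \<le> M) \<Longrightarrow> i \<le> k \<Longrightarrow> \<bar>c i\<bar> \<le> C * M"
    using poly_coeff_bound[of k] by metis
  \<comment> \<open>An error C * b * t^2 is allowed for each of the k + 1 coefficients.\<close>
  define K where "K = real (k + 1) * C"
  have K: "K \<ge> C" "K > 0" using \<open>C \<ge> 1\<close> by (auto simp: K_def algebra_simps add_pos_nonneg)
  have main: "(c 1)\<^sup>2 \<le> 4 * K * (a * b)"
    if c0: "c 0 = 0" and "a \<le> b"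
      and q: "\<And>t. \<bar>t\<bar> \<le> 1 \<Longrightarrow> - a \<le> (\<Sum>i\<le>k. c i * t ^ i) \<and> (\<Sum>i\<le>k. c i * t ^ i) \<le> b"
    for c :: "nat \<Rightarrow> real" and a b
  proof -
    have "(\<Sum>i\<le>k. c i * 0 ^ i) = 0"
      using c0 by (intro sum.neutral) (auto simp: power_0_left)
    then have "a \<ge> 0" using q[of 0] by simp
    have ci: "\<bar>c i\<bar> \<le> C * b" if "i \<le> k" for i
    proof (rule C[OF _ that])
      fix t :: real assume "\<bar>t\<bar> \<le> 1"
      then show "\<bar>\<Sum>i\<le>k. c i * t ^ i\<bar> \<le> b" using q[of t] \<open>a \<le> b\<close> by linarith
    qed
    show ?thesis
    proof (cases "b = 0")
      case True
      then show ?thesis using ci[OF k] by simp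
    next
      case False
      then have "b > 0" using \<open>a \<ge> 0\<close> \<open>a \<le> b\<close> by simp
      \<comment> \<open>The minimiser of the parabola c 1 * t + K * b * t^2 that dominates the
        polynomial; it lies in [-1, 1] because K >= C.\<close>
      define t where "t = - c 1 / (2 * K * b)"
      have "\<bar>c 1\<bar> \<le> K * b"
        using ci[OF k] K \<open>b > 0\<close> mult_right_mono[of C K b] by linarith
      then have t: "\<bar>t\<bar> \<le> 1"
        using K \<open>b > 0\<close> by (simp add: t_def abs_divide abs_mult divide_simps)
      have "c i * t ^ i \<le> (if i = 1 then c 1 * t else 0) + C * b * t\<^sup>2" if i: "i \<le> k" for i
      proof -
        consider "i = 0" | "i = 1" | "i \<ge> 2" by linarith
        then show ?thesis
        proof cases
          case 3
          have "c i * t ^ i \<le> \<bar>c i\<bar> * \<bar>t\<bar> ^ i"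
            by (metis abs_ge_self abs_mult power_abs)
          also have "\<dots> \<le> (C * b) * \<bar>t\<bar> ^ 2"
            using ci[OF i] t 3 by (intro mult_mono power_decreasing) auto
          finally show ?thesis using 3 by simp
        qed (use c0 \<open>b > 0\<close> \<open>C \<ge> 1\<close> in auto)
      qed
      then have "(\<Sum>i\<le>k. c i * t ^ i) \<le> (\<Sum>i\<le>k. (if i = 1 then c 1 * t else 0) + C * b * t\<^sup>2)"
        by (intro sum_mono) auto
      also have "\<dots> = c 1 * t + K * b * t\<^sup>2"
        using k by (simp add: sum.distrib K_def algebra_simps)
      finally have "- a \<le> c 1 * t + K * b * t\<^sup>2"
        using q[OF t] by linarith
      also have "\<dots> = - (c 1)\<^sup>2 / (4 * K * b)"
        using K \<open>b > 0\<close> by (simp add: t_def power2_eq_square field_simps)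
      finally show ?thesis
        using K \<open>b > 0\<close> by (simp add: field_simps)
    qed
  qed
  \<comment> \<open>Negating the polynomial swaps a and b, so \<open>main\<close> also covers the
    case a > b.\<close>
  have "(c 1)\<^sup>2 \<le> 4 * K * (a * b)"
    if c0: "c 0 = 0"
      and q: "\<And>t. \<bar>t\<bar> \<le> 1 \<Longrightarrow> - a \<le> (\<Sum>i\<le>k. c i * t ^ i) \<and> (\<Sum>i\<le>k. c i * t ^ i) \<le> b"
    for c :: "nat \<Rightarrow> real" and a b
  proof (cases "a \<le> b")
    case False
    have "(- c 1)\<^sup>2 \<le> 4 * K * (b * a)"
      using False c0 q by (intro main[of "\<lambda>i. - c i"]) (auto simp: sum_negf minus_le_iff[of _ a])
    then show ?thesis by (simp add: mult.commute)
  qed (use main[OF c0 _ q] in auto)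
  then show ?thesis using K by (intro exI[of _ "4 * K"]) (auto simp: slope_constant_def)
qed

section \<open>Alternating sums over disjoint pairs\<close>

lemma finite_ksubsets [simp]: "finite V \<Longrightarrow> finite (ksubsets V k)"
  by (auto simp: ksubsets_def intro: finite_subset[of _ "Pow V"])

lemma card_ksubsets: "finite V \<Longrightarrow> card (ksubsets V k) = card V choose k"
  by (simp add: ksubsets_def n_subsets)

lemma ksubsets_0 [simp]: "finite V \<Longrightarrow> ksubsets V 0 = {{}}"
  by (auto simp: ksubsets_def dest: finite_subset)

definition pair_sign :: "'a \<times> 'a \<Rightarrow> 'a set \<Rightarrow> real" where
  "pair_sign p e = of_bool (fst p \<in> e) - of_bool (snd p \<in> e)"

definition alt_sign :: "('a \<times> 'a) list \<Rightarrow> 'a set \<Rightarrow> real" where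
  "alt_sign ps e = (\<Prod>p\<leftarrow>ps. pair_sign p e)"

text \<open>Pairs and lists are ordered, so each family of j disjoint pairs occurs 2^j * j! times.
  The recursion removes one pair from the vertex set, matching the inductions that differentiate
  along one pair.\<close>

fun disjoint_pairs :: "nat \<Rightarrow> 'a set \<Rightarrow> ('a \<times> 'a) list set" where
  "disjoint_pairs 0 V = {[]}"
| "disjoint_pairs (Suc j) V =
     (\<Union>p\<in>{p \<in> V \<times> V. fst p \<noteq> snd p}. (#) p ` disjoint_pairs j (V - {fst p, snd p}))"

definition alt_coeff :: "'a set \<Rightarrow> nat \<Rightarrow> ('a set \<Rightarrow> real) \<Rightarrow> ('a \<times> 'a) list \<Rightarrow> real" where
  "alt_coeff V k w ps = (\<Sum>e\<in>ksubsets V k. w e * alt_sign ps e)"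

definition alt_norm :: "'a set \<Rightarrow> nat \<Rightarrow> nat \<Rightarrow> ('a set \<Rightarrow> real) \<Rightarrow> real" where
  "alt_norm V k j w = (\<Sum>ps\<in>disjoint_pairs j V. \<bar>alt_coeff V k w ps\<bar>)"

section \<open>Discrete derivatives, degrees and the alternating norms\<close>

definition pair_diff :: "'a \<times> 'a \<Rightarrow> ('a set \<Rightarrow> real) \<Rightarrow> 'a set \<Rightarrow> real" where
  "pair_diff p w f = w (insert (fst p) f) - w (insert (snd p) f)"

text \<open>The weighted degree of \<open>f\<close>: the down operator from (k+1)-uniform to
  k-uniform weightings.\<close>

definition shadow :: "'a set \<Rightarrow> ('a set \<Rightarrow> real) \<Rightarrow> 'a set \<Rightarrow> real" where
  "shadow V w f = (\<Sum>z\<in>V - f. w (insert z f))"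

lemma finite_disjoint_pairs [simp]: "finite V \<Longrightarrow> finite (disjoint_pairs j V)"
  by (induction j arbitrary: V) auto

lemma disjoint_pairs_subset:
  "ps \<in> disjoint_pairs j V \<Longrightarrow> p \<in> set ps \<Longrightarrow> fst p \<in> V \<and> snd p \<in> V"
proof (induction j arbitrary: V ps)
  case (Suc j)
  then obtain q qs where q: "q \<in> V \<times> V" and qs: "qs \<in> disjoint_pairs j (V - {fst q, snd q})"
    and ps: "ps = q # qs"
    by auto
  show ?case
  proof (cases "p = q")
    case False
    then have "fst p \<in> V - {fst q, snd q} \<and> snd p \<in> V - {fst q, snd q}"
      using Suc.IH[OF qs] Suc.prems(2) ps by simp
    then show ?thesis by simp
  qed (use q in auto)
qed simp

lemma alt_norm_nonneg: "0 \<le> alt_norm V k j w"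
  by (simp add: alt_norm_def sum_nonneg)

lemma alt_sign_insert_absent:
  "(\<And>p. p \<in> set ps \<Longrightarrow> fst p \<noteq> x \<and> snd p \<noteq> x) \<Longrightarrow> alt_sign ps (insert x f) = alt_sign ps f"
  unfolding alt_sign_def by (intro arg_cong[where f = prod_list] map_cong) (auto simp: pair_sign_def)

lemma sum_ksubsets_Suc:
  assumes "finite V"
  shows "(\<Sum>f\<in>ksubsets V k. \<Sum>z\<in>V - f. F f z) = (\<Sum>e\<in>ksubsets V (Suc k). \<Sum>z\<in>e. F (e - {z}) z)"
proof -
  have fin: "finite e" if "e \<in> ksubsets V k" for e k
    using that assms finite_subset by (auto simp: ksubsets_def)
  have "(\<Sum>f\<in>ksubsets V k. \<Sum>z\<in>V - f. F f z) = (\<Sum>(f, z)\<in>Sigma (ksubsets V k) (\<lambda>f. V - f). F f z)"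
    using assms by (intro sum.Sigma) auto
  also have "\<dots> = (\<Sum>(e, z)\<in>Sigma (ksubsets V (Suc k)) (\<lambda>e. e). F (e - {z}) z)"
  proof (rule sum.reindex_bij_witness[where i = "\<lambda>(e, z). (e - {z}, z)" and j = "\<lambda>(f, z). (insert z f, z)"])
    fix q assume q: "q \<in> Sigma (ksubsets V k) (\<lambda>f. V - f)"
    then have "finite (fst q)" using fin by auto
    with q show "(case q of (f, z) \<Rightarrow> (insert z f, z)) \<in> Sigma (ksubsets V (Suc k)) (\<lambda>e. e)"
      by (auto simp: ksubsets_def)
  next
    fix q assume q: "q \<in> Sigma (ksubsets V (Suc k)) (\<lambda>e. e)"
    then have "finite (fst q)" using fin by auto
    with q show "(case q of (e, z) \<Rightarrow> (e - {z}, z)) \<in> Sigma (ksubsets V k) (\<lambda>f. V - f)"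
      by (auto simp: ksubsets_def)
  qed auto
  also have "\<dots> = (\<Sum>e\<in>ksubsets V (Suc k). \<Sum>z\<in>e. F (e - {z}) z)"
    using assms fin by (intro sum.Sigma[symmetric]) auto
  finally show ?thesis .
qed

lemma sum_ksubsets_insert:
  assumes "finite V" "x \<in> V" "x \<noteq> y"
  shows "(\<Sum>e\<in>{e \<in> ksubsets V (Suc k). x \<in> e \<and> y \<notin> e}. F e)
    = (\<Sum>f\<in>ksubsets (V - {x, y}) k. F (insert x f))"
proof -
  have fin: "card (insert x f) = Suc (card f)" if "f \<subseteq> V - {x, y}" for f
    using that assms finite_subset[of f V] by (subst card_insert_disjoint) auto
  show ?thesis
    by (rule sum.reindex_bij_witness[where i = "insert x" and j = "\<lambda>e. e - {x}"])
      (use assms fin in \<open>auto simp: ksubsets_def insert_absorb\<close>)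
qed

text \<open>Edges containing both or neither vertex of \<open>p\<close> have sign 0. The others
  consist of one vertex of \<open>p\<close> and a k-set avoiding \<open>p\<close>, with opposite
  signs for the two vertices, so the first pair acts as a discrete derivative.\<close>

lemma alt_coeff_Cons:
  assumes "finite V" and p: "p \<in> V \<times> V" "fst p \<noteq> snd p"
    and ps: "ps \<in> disjoint_pairs j (V - {fst p, snd p})"
  shows "alt_coeff V (Suc k) w (p # ps) = alt_coeff (V - {fst p, snd p}) k (pair_diff p w) ps"
proof -
  obtain x y where xy: "p = (x, y)" by fastforce
  have sign: "alt_sign ps (insert x f) = alt_sign ps f" "alt_sign ps (insert y f) = alt_sign ps f" for f
    using disjoint_pairs_subset[OF ps] by (auto simp: xy intro!: alt_sign_insert_absent)
  have "alt_coeff V (Suc k) w (p # ps)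
    = (\<Sum>e\<in>ksubsets V (Suc k). (if x \<in> e \<and> y \<notin> e then w e * alt_sign ps e else 0)
        - (if y \<in> e \<and> x \<notin> e then w e * alt_sign ps e else 0))"
    unfolding alt_coeff_def by (intro sum.cong) (auto simp: alt_sign_def pair_sign_def xy)
  also have "\<dots> = (\<Sum>e\<in>{e \<in> ksubsets V (Suc k). x \<in> e \<and> y \<notin> e}. w e * alt_sign ps e)
      - (\<Sum>e\<in>{e \<in> ksubsets V (Suc k). y \<in> e \<and> x \<notin> e}. w e * alt_sign ps e)"
    using assms(1) by (simp add: sum_subtractf sum.inter_filter)
  also have "\<dots> = (\<Sum>f\<in>ksubsets (V - {x, y}) k. w (insert x f) * alt_sign ps f)
      - (\<Sum>f\<in>ksubsets (V - {x, y}) k. w (insert y f) * alt_sign ps f)"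
    using p assms(1) sum_ksubsets_insert[of V x y "\<lambda>e. w e * alt_sign ps e" k]
      sum_ksubsets_insert[of V y x "\<lambda>e. w e * alt_sign ps e" k]
    by (simp add: xy sign insert_commute)
  also have "\<dots> = alt_coeff (V - {fst p, snd p}) k (pair_diff p w) ps"
    by (simp add: alt_coeff_def pair_diff_def xy sum_subtractf left_diff_distrib)
  finally show ?thesis .
qed

lemma alt_norm_Suc:
  assumes "finite V"
  shows "alt_norm V (Suc k) (Suc j) w
    = (\<Sum>p\<in>{p \<in> V \<times> V. fst p \<noteq> snd p}. alt_norm (V - {fst p, snd p}) k j (pair_diff p w))"
proof -
  let ?P = "{p \<in> V \<times> V. fst p \<noteq> snd p}"
  have "alt_norm V (Suc k) (Suc j) w
      = (\<Sum>p\<in>?P. \<Sum>qs\<in>(#) p ` disjoint_pairs j (V - {fst p, snd p}). \<bar>alt_coeff V (Suc k) w qs\<bar>)"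
    unfolding alt_norm_def disjoint_pairs.simps using assms
    by (intro sum.UNION_disjoint) auto
  also have "\<dots> = (\<Sum>p\<in>?P. alt_norm (V - {fst p, snd p}) k j (pair_diff p w))"
  proof (rule sum.cong[OF refl])
    fix p assume p: "p \<in> ?P"
    have "inj_on ((#) p) X" for X by (simp add: inj_on_def)
    then show "(\<Sum>qs\<in>(#) p ` disjoint_pairs j (V - {fst p, snd p}). \<bar>alt_coeff V (Suc k) w qs\<bar>)
        = alt_norm (V - {fst p, snd p}) k j (pair_diff p w)"
      using p by (simp add: sum.reindex alt_norm_def alt_coeff_Cons[OF assms])
  qed
  finally show ?thesis .
qed

text \<open>The two degrees share the edge containing both vertices of \<open>p\<close>, which
  cancels in the difference.\<close>

lemma pair_diff_shadow:
  assumes "finite V" "p \<in> V \<times> V" "fst p \<noteq> snd p" "f \<subseteq> V - {fst p, snd p}"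
  shows "pair_diff p (shadow V w) f = shadow (V - {fst p, snd p}) (pair_diff p w) f"
proof -
  obtain x y where xy: "p = (x, y)" by fastforce
  let ?U = "V - {x, y} - f"
  have "V - insert x f = insert y ?U" "V - insert y f = insert x ?U"
    using assms by (auto simp: xy)
  then have "shadow V w (insert x f) = w (insert y (insert x f)) + (\<Sum>z\<in>?U. w (insert z (insert x f)))"
    "shadow V w (insert y f) = w (insert x (insert y f)) + (\<Sum>z\<in>?U. w (insert z (insert y f)))"
    using assms(1) by (simp_all add: shadow_def)
  then show ?thesis
    by (simp add: xy pair_diff_def shadow_def sum_subtractf insert_commute)
qed

text \<open>An edge of size k + 1 with nonzero sign has one vertex in each pair. Removing one of
  these makes the sign 0, removing any of the other k + 1 - j vertices preserves it. For j > k + 1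
  there is no such edge, in agreement with the truncated subtraction.\<close>

lemma alt_coeff_shadow:
  assumes "finite V" "ps \<in> disjoint_pairs j V"
  shows "alt_coeff V k (shadow V w) ps = real (Suc k - j) * alt_coeff V (Suc k) w ps"
  using assms
proof (induction j arbitrary: V k w ps)
  case 0
  have fin: "finite e" if "e \<in> ksubsets V (Suc k)" for e
    using that 0 finite_subset by (auto simp: ksubsets_def)
  have "alt_coeff V k (shadow V w) ps = (\<Sum>f\<in>ksubsets V k. \<Sum>z\<in>V - f. w (insert z f))"
    using 0 by (simp add: alt_coeff_def alt_sign_def shadow_def)
  also have "\<dots> = (\<Sum>e\<in>ksubsets V (Suc k). \<Sum>z\<in>e. w e)"
    unfolding sum_ksubsets_Suc[OF 0(1)] by (simp add: insert_absorb)
  also have "\<dots> = real (Suc k) * (\<Sum>e\<in>ksubsets V (Suc k). w e)"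
    unfolding sum_distrib_left by (intro sum.cong refl) (auto simp: ksubsets_def)
  finally show ?case using 0 by (simp add: alt_coeff_def alt_sign_def)
next
  case (Suc j)
  from Suc.prems(2) obtain p qs where p: "p \<in> V \<times> V" "fst p \<noteq> snd p"
    and qs: "qs \<in> disjoint_pairs j (V - {fst p, snd p})" and ps: "ps = p # qs"
    by auto
  show ?case
  proof (cases k)
    \<comment> \<open>The empty set has sign 0 for a nonempty list, and the factor is truncated to
      0.\<close>
    case 0
    then show ?thesis
      using Suc.prems(1) by (simp add: ps alt_coeff_def alt_sign_def pair_sign_def)
  next
    case k: (Suc k')
    have "alt_coeff V k (shadow V w) ps
        = alt_coeff (V - {fst p, snd p}) k' (pair_diff p (shadow V w)) qs"
      unfolding ps k by (rule alt_coeff_Cons[OF Suc.prems(1) p qs])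
    also have "\<dots> = alt_coeff (V - {fst p, snd p}) k' (shadow (V - {fst p, snd p}) (pair_diff p w)) qs"
      unfolding alt_coeff_def
      by (intro sum.cong refl) (simp add: pair_diff_shadow[OF Suc.prems(1) p] ksubsets_def)
    also have "\<dots> = real (Suc k' - j) * alt_coeff (V - {fst p, snd p}) (Suc k') (pair_diff p w) qs"
      using Suc.prems(1) qs by (intro Suc.IH) auto
    also have "\<dots> = real (Suc k - Suc j) * alt_coeff V (Suc k) w ps"
      unfolding ps k using alt_coeff_Cons[OF Suc.prems(1) p qs] by simp
    finally show ?thesis .
  qed
qed

lemma alt_norm_shadow_le:
  assumes "finite V"
  shows "alt_norm V k j (shadow V w) \<le> real (Suc k) * alt_norm V (Suc k) j w"
  unfolding alt_norm_def sum_distrib_left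
proof (rule sum_mono)
  fix ps assume "ps \<in> disjoint_pairs j V"
  then have "\<bar>alt_coeff V k (shadow V w) ps\<bar> = real (Suc k - j) * \<bar>alt_coeff V (Suc k) w ps\<bar>"
    by (simp add: alt_coeff_shadow[OF assms] abs_mult)
  also have "\<dots> \<le> real (Suc k) * \<bar>alt_coeff V (Suc k) w ps\<bar>"
    by (intro mult_right_mono) auto
  finally show "\<bar>alt_coeff V k (shadow V w) ps\<bar> \<le> real (Suc k) * \<bar>alt_coeff V (Suc k) w ps\<bar>" .
qed

text \<open>The value at \<open>insert x f\<close> is the average, over the vertices
  \<open>y\<close> outside \<open>f\<close>, of the value at \<open>insert y f\<close> plus a pair
  difference. The first part is the shadow of \<open>f\<close> divided by the number m = n - k of
  these vertices, and m >= n / 2.\<close>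

lemma hnorm1_Suc_le:
  assumes V: "finite V" and n: "2 * Suc k \<le> card V"
  shows "hnorm1 V (Suc k) w
    \<le> 2 / real (card V) * (\<Sum>p\<in>{p \<in> V \<times> V. fst p \<noteq> snd p}. hnorm1 (V - {fst p, snd p}) k (pair_diff p w))
      + hnorm1 V k (shadow V w)"
proof -
  define m where "m = real (card V) - real k"
  have m: "m > 0" "1 / m \<le> 2 / real (card V)" using n by (auto simp: m_def field_simps)
  have fin: "finite f" "card (V - f) = card V - k" "m = real (card (V - f))" if "f \<in> ksubsets V k" for f
  proof -
    have "f \<subseteq> V" "card f = k" using that by (auto simp: ksubsets_def)
    then show "finite f" "card (V - f) = card V - k" "m = real (card (V - f))"
      using V finite_subset[of f V] n by (auto simp: card_Diff_subset m_def of_nat_diff)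
  qed
  have point: "m * \<bar>w (insert x f)\<bar> \<le> (\<Sum>y\<in>V - f - {x}. \<bar>pair_diff (x, y) w f\<bar>) + \<bar>shadow V w f\<bar>"
    if f: "f \<in> ksubsets V k" and x: "x \<in> V - f" for f x
  proof -
    have "(\<Sum>y\<in>V - f. pair_diff (x, y) w f) = m * w (insert x f) - shadow V w f"
      by (simp add: pair_diff_def sum_subtractf shadow_def fin(3)[OF f])
    moreover have "(\<Sum>y\<in>V - f. pair_diff (x, y) w f) = (\<Sum>y\<in>V - f - {x}. pair_diff (x, y) w f)"
      using V x by (simp add: sum.remove[of "V - f" x] pair_diff_def)
    moreover have "\<bar>\<Sum>y\<in>V - f - {x}. pair_diff (x, y) w f\<bar> \<le> (\<Sum>y\<in>V - f - {x}. \<bar>pair_diff (x, y) w f\<bar>)"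
      by (rule sum_abs)
    moreover have "\<bar>m * w (insert x f)\<bar> = m * \<bar>w (insert x f)\<bar>"
      using m by (simp add: abs_mult)
    ultimately show ?thesis by linarith
  qed
  have "m * hnorm1 V (Suc k) w \<le> m * (\<Sum>e\<in>ksubsets V (Suc k). \<Sum>z\<in>e. \<bar>w e\<bar>)"
    unfolding hnorm1_def using m by (intro mult_left_mono sum_mono) (auto simp: ksubsets_def algebra_simps)
  also have "(\<Sum>e\<in>ksubsets V (Suc k). \<Sum>z\<in>e. \<bar>w e\<bar>) = (\<Sum>f\<in>ksubsets V k. \<Sum>x\<in>V - f. \<bar>w (insert x f)\<bar>)"
    unfolding sum_ksubsets_Suc[OF V] by (simp add: insert_absorb)
  also have "m * \<dots> \<le> (\<Sum>f\<in>ksubsets V k. \<Sum>x\<in>V - f. (\<Sum>y\<in>V - f - {x}. \<bar>pair_diff (x, y) w f\<bar>) + \<bar>shadow V w f\<bar>)"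
    unfolding sum_distrib_left using point by (intro sum_mono) auto
  also have "\<dots> = (\<Sum>f\<in>ksubsets V k. \<Sum>x\<in>V - f. \<Sum>y\<in>V - f - {x}. \<bar>pair_diff (x, y) w f\<bar>)
      + m * hnorm1 V k (shadow V w)"
    unfolding sum.distrib hnorm1_def sum_distrib_left using fin(3) by simp
  also have "(\<Sum>f\<in>ksubsets V k. \<Sum>x\<in>V - f. \<Sum>y\<in>V - f - {x}. \<bar>pair_diff (x, y) w f\<bar>)
      = (\<Sum>f\<in>ksubsets V k. \<Sum>p\<in>{p \<in> V \<times> V. fst p \<noteq> snd p}. if fst p \<notin> f \<and> snd p \<notin> f then \<bar>pair_diff p w f\<bar> else 0)"
  proof (intro sum.cong refl)
    fix f
    have "(\<Sum>x\<in>V - f. \<Sum>y\<in>V - f - {x}. \<bar>pair_diff (x, y) w f\<bar>)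
        = (\<Sum>p\<in>{p \<in> V \<times> V. fst p \<noteq> snd p} \<inter> {p. fst p \<notin> f \<and> snd p \<notin> f}. \<bar>pair_diff p w f\<bar>)"
      using V by (subst sum.Sigma) (auto intro!: sum.cong)
    then show "(\<Sum>x\<in>V - f. \<Sum>y\<in>V - f - {x}. \<bar>pair_diff (x, y) w f\<bar>)
        = (\<Sum>p\<in>{p \<in> V \<times> V. fst p \<noteq> snd p}. if fst p \<notin> f \<and> snd p \<notin> f then \<bar>pair_diff p w f\<bar> else 0)"
      using V by (simp add: sum.If_cases)
  qed
  also have "\<dots> = (\<Sum>p\<in>{p \<in> V \<times> V. fst p \<noteq> snd p}. hnorm1 (V - {fst p, snd p}) k (pair_diff p w))"
  proof (subst sum.swap, intro sum.cong refl)
    fix p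
    have "ksubsets (V - {fst p, snd p}) k = ksubsets V k \<inter> {f. fst p \<notin> f \<and> snd p \<notin> f}"
      by (auto simp: ksubsets_def)
    then show "(\<Sum>f\<in>ksubsets V k. if fst p \<notin> f \<and> snd p \<notin> f then \<bar>pair_diff p w f\<bar> else 0)
        = hnorm1 (V - {fst p, snd p}) k (pair_diff p w)"
      using V by (simp add: hnorm1_def sum.If_cases)
  qed
  finally have "hnorm1 V (Suc k) w \<le> 1 / m * (\<Sum>p\<in>{p \<in> V \<times> V. fst p \<noteq> snd p}. hnorm1 (V - {fst p, snd p}) k (pair_diff p w))
      + hnorm1 V k (shadow V w)"
    using m by (simp add: field_simps)
  also have "1 / m * (\<Sum>p\<in>{p \<in> V \<times> V. fst p \<noteq> snd p}. hnorm1 (V - {fst p, snd p}) k (pair_diff p w))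
      \<le> 2 / real (card V) * (\<Sum>p\<in>{p \<in> V \<times> V. fst p \<noteq> snd p}. hnorm1 (V - {fst p, snd p}) k (pair_diff p w))"
    using m(2) by (intro mult_right_mono sum_nonneg) (auto simp: hnorm1_def sum_nonneg)
  finally show ?thesis by simp
qed

text \<open>A quantitative form of the fact that the alternating sums of orders 0 to k determine
  \<open>w\<close>. In the induction, order j for the pair differences is order j + 1 for
  \<open>w\<close>, whereas the shadow keeps the order.\<close>

lemma hnorm1_le_alt_norms:
  "\<exists>C>0. \<forall>(V :: 'a set) w. finite V \<longrightarrow> 2 * k \<le> card V \<longrightarrow>
     hnorm1 V k w \<le> C * (\<Sum>j\<le>k. alt_norm V k j w / real (card V) ^ j)"
proof (induction k)
  case 0
  show ?case
    by (intro exI[of _ 1]) (simp add: hnorm1_def alt_norm_def alt_coeff_def alt_sign_def)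
next
  case (Suc k)
  then obtain C where "C > 0" and C: "\<And>(V :: 'a set) w. finite V \<Longrightarrow> 2 * k \<le> card V \<Longrightarrow>
     hnorm1 V k w \<le> C * (\<Sum>j\<le>k. alt_norm V k j w / real (card V) ^ j)"
    by metis
  define D where "D = C * (2 * 2 ^ k + real (Suc k))"
  show ?case
  proof (intro exI[of _ D] conjI allI impI)
    show "D > 0" using \<open>C > 0\<close> by (simp add: D_def add_pos_pos)
  next
    fix V :: "'a set" and w
    assume V: "finite V" and n: "2 * Suc k \<le> card V"
    define N where "N = real (card V)"
    have N: "N > 0" using n by (simp add: N_def)
    let ?P = "{p \<in> V \<times> V. fst p \<noteq> snd p}"
    let ?S = "\<Sum>j\<le>Suc k. alt_norm V (Suc k) j w / N ^ j"
    have "hnorm1 (V - {fst p, snd p}) k (pair_diff p w)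
        \<le> C * (\<Sum>j\<le>k. alt_norm (V - {fst p, snd p}) k j (pair_diff p w) * (2 ^ k / N ^ j))"
      if p: "p \<in> ?P" for p
    proof -
      have card: "card (V - {fst p, snd p}) = card V - 2"
        using p V by (subst card_Diff_subset) auto
      have "hnorm1 (V - {fst p, snd p}) k (pair_diff p w)
          \<le> C * (\<Sum>j\<le>k. alt_norm (V - {fst p, snd p}) k j (pair_diff p w) / real (card V - 2) ^ j)"
        using C[of "V - {fst p, snd p}" "pair_diff p w"] V n by (simp add: card)
      also have "\<dots> \<le> C * (\<Sum>j\<le>k. alt_norm (V - {fst p, snd p}) k j (pair_diff p w) * (2 ^ k / N ^ j))"
      proof (intro mult_left_mono sum_mono)
        fix j assume j: "j \<in> {..k}"
        have "1 / real (card V - 2) ^ j \<le> 2 ^ k / N ^ j"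
        \<comment> \<open>For k = 0 only j = 0 occurs and both powers are 1, even if two vertices
          are all there are. For k > 0 there are at least 4 vertices, so n <= 2 (n - 2).\<close>
        proof (cases "k = 0")
          case False
          then have half: "N \<le> 2 * real (card V - 2)" and pos: "real (card V - 2) > 0"
            using n by (auto simp: N_def of_nat_diff)
          have "N ^ j \<le> (2 * real (card V - 2)) ^ j"
            using half N by (intro power_mono) auto
          also have "\<dots> = 2 ^ j * real (card V - 2) ^ j"
            by (rule power_mult_distrib)
          also have "\<dots> \<le> 2 ^ k * real (card V - 2) ^ j"
            using j by (intro mult_right_mono power_increasing) auto
          finally show ?thesis
            using N pos by (simp add: divide_simps)
        qed (use j in simp)
        then show "alt_norm (V - {fst p, snd p}) k j (pair_diff p w) / real (card V - 2) ^ j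
            \<le> alt_norm (V - {fst p, snd p}) k j (pair_diff p w) * (2 ^ k / N ^ j)"
          using mult_left_mono[OF _ alt_norm_nonneg[of "V - {fst p, snd p}" k j "pair_diff p w"]]
          by (metis mult.right_neutral times_divide_eq_right)
      qed (use \<open>C > 0\<close> in auto)
      finally show ?thesis .
    qed
    then have "(\<Sum>p\<in>?P. hnorm1 (V - {fst p, snd p}) k (pair_diff p w))
        \<le> (\<Sum>p\<in>?P. C * (\<Sum>j\<le>k. alt_norm (V - {fst p, snd p}) k j (pair_diff p w) * (2 ^ k / N ^ j)))"
      by (rule sum_mono)
    also have "\<dots> = C * (\<Sum>j\<le>k. alt_norm V (Suc k) (Suc j) w * (2 ^ k / N ^ j))"
      unfolding alt_norm_Suc[OF V] sum_distrib_left[symmetric] sum_distrib_right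
      by (subst sum.swap) simp
    finally have "2 / N * (\<Sum>p\<in>?P. hnorm1 (V - {fst p, snd p}) k (pair_diff p w))
        \<le> 2 / N * (C * (\<Sum>j\<le>k. alt_norm V (Suc k) (Suc j) w * (2 ^ k / N ^ j)))"
      using N by (intro mult_left_mono) auto
    also have "\<dots> = C * (2 * 2 ^ k) * (\<Sum>j\<le>k. alt_norm V (Suc k) (Suc j) w / N ^ Suc j)"
      unfolding sum_distrib_left by (intro sum.cong refl) simp
    also have "\<dots> \<le> C * (2 * 2 ^ k) * ?S"
    proof (rule mult_left_mono)
      show "(\<Sum>j\<le>k. alt_norm V (Suc k) (Suc j) w / N ^ Suc j) \<le> ?S"
        unfolding sum.atMost_Suc_shift using alt_norm_nonneg[of V "Suc k" 0 w] by simp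
    qed (use \<open>C > 0\<close> in auto)
    finally have 1: "2 / N * (\<Sum>p\<in>?P. hnorm1 (V - {fst p, snd p}) k (pair_diff p w)) \<le> C * (2 * 2 ^ k) * ?S" .
    have "hnorm1 V k (shadow V w) \<le> C * (\<Sum>j\<le>k. alt_norm V k j (shadow V w) / N ^ j)"
      using C[OF V, of "shadow V w"] n by (simp add: N_def)
    also have "\<dots> \<le> C * (\<Sum>j\<le>k. real (Suc k) * alt_norm V (Suc k) j w / N ^ j)"
      using \<open>C > 0\<close> N by (intro mult_left_mono sum_mono divide_right_mono alt_norm_shadow_le V) auto
    also have "\<dots> = C * real (Suc k) * (\<Sum>j\<le>k. alt_norm V (Suc k) j w / N ^ j)"
      by (simp add: sum_distrib_left mult.assoc)
    also have "\<dots> \<le> C * real (Suc k) * ?S"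
      using \<open>C > 0\<close> N alt_norm_nonneg[of V "Suc k" "Suc k" w] by (intro mult_left_mono) auto
    finally have 2: "hnorm1 V k (shadow V w) \<le> C * real (Suc k) * ?S" .
    show "hnorm1 V (Suc k) w \<le> D * (\<Sum>j\<le>Suc k. alt_norm V (Suc k) j w / real (card V) ^ j)"
      using hnorm1_Suc_le[OF V n, of w] 1 2 unfolding D_def N_def[symmetric]
      by (simp only: distrib_left distrib_right)
  qed
qed

section \<open>Exchanging pairs of vertices\<close>

definition perm_avg :: "'a set \<Rightarrow> (('a \<Rightarrow> 'a) \<Rightarrow> real) \<Rightarrow> real" where
  "perm_avg V F = (\<Sum>\<pi> | \<pi> permutes V. F \<pi>) / fact (card V)"

lemma perm_avg_compose:
  assumes "\<rho> permutes V"
  shows "perm_avg V (\<lambda>\<pi>. F (\<pi> \<circ> \<rho>)) = perm_avg V F"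
  using sum_permutations_compose_right[OF assms, of F] by (simp add: perm_avg_def)

lemma perm_avg_sum: "perm_avg V (\<lambda>\<pi>. \<Sum>x\<in>X. F x \<pi>) = (\<Sum>x\<in>X. perm_avg V (F x))"
  unfolding perm_avg_def by (subst sum.swap) (simp add: sum_divide_distrib)

lemma perm_avg_mult: "perm_avg V (\<lambda>\<pi>. c * F \<pi>) = c * perm_avg V F"
  by (simp add: perm_avg_def sum_distrib_left)

lemma perm_avg_mono:
  "(\<And>\<pi>. \<pi> permutes V \<Longrightarrow> F \<pi> \<le> G \<pi>) \<Longrightarrow> perm_avg V F \<le> perm_avg V G"
  unfolding perm_avg_def by (intro divide_right_mono sum_mono) auto

lemma perm_avg_cong:
  "(\<And>\<pi>. \<pi> permutes V \<Longrightarrow> F \<pi> = G \<pi>) \<Longrightarrow> perm_avg V F = perm_avg V G"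
  by (simp add: perm_avg_def)

lemma perm_avg_const: "finite V \<Longrightarrow> perm_avg V (\<lambda>\<pi>. c) = c"
  by (simp add: perm_avg_def card_permutations)

lemma perm_avg_nonneg: "(\<And>\<pi>. \<pi> permutes V \<Longrightarrow> 0 \<le> F \<pi>) \<Longrightarrow> 0 \<le> perm_avg V F"
  unfolding perm_avg_def by (intro divide_nonneg_nonneg sum_nonneg) auto

text \<open>A uniform permutation composed with an independent random exchange is again uniform, so
  the extra randomness may be introduced or removed freely.\<close>

lemma perm_avg_cube_avg:
  assumes "\<And>S. S \<subseteq> I \<Longrightarrow> \<rho> S permutes V" "finite I"
  shows "perm_avg V (\<lambda>\<pi>. cube_avg I (\<lambda>S. F (\<pi> \<circ> \<rho> S))) = perm_avg V F"
proof -
  have "perm_avg V (\<lambda>\<pi>. cube_avg I (\<lambda>S. F (\<pi> \<circ> \<rho> S)))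
      = cube_avg I (\<lambda>S. perm_avg V (\<lambda>\<pi>. F (\<pi> \<circ> \<rho> S)))"
    unfolding perm_avg_def cube_avg_def sum_divide_distrib
    by (subst sum.swap) (simp add: divide_divide_eq_left mult.commute)
  also have "\<dots> = cube_avg I (\<lambda>S. perm_avg V F)"
    using assms by (intro cube_avg_cong perm_avg_compose)
  finally show ?thesis using assms by (simp add: cube_avg_const)
qed

lemma sum_swap3:
  "(\<Sum>a\<in>A. \<Sum>b\<in>B. \<Sum>c\<in>C. F a b c) = (\<Sum>c\<in>C. \<Sum>b\<in>B. \<Sum>a\<in>A. F a b c)"
proof -
  have "(\<Sum>a\<in>A. \<Sum>b\<in>B. \<Sum>c\<in>C. F a b c) = (\<Sum>b\<in>B. \<Sum>a\<in>A. \<Sum>c\<in>C. F a b c)"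
    by (rule sum.swap)
  also have "\<dots> = (\<Sum>b\<in>B. \<Sum>c\<in>C. \<Sum>a\<in>A. F a b c)"
    by (intro sum.cong refl sum.swap)
  also have "\<dots> = (\<Sum>c\<in>C. \<Sum>b\<in>B. \<Sum>a\<in>A. F a b c)"
    by (rule sum.swap)
  finally show ?thesis .
qed

lemma permutes_map_list:
  assumes "distinct xs" "distinct ys" "length xs = length ys" "set xs \<subseteq> V" "set ys \<subseteq> V"
  shows "\<exists>\<rho>. \<rho> permutes V \<and> map \<rho> xs = ys"
  using assms
proof (induction xs ys rule: list_induct2')
  case 1
  show ?case by (intro exI[of _ id]) (simp add: permutes_def)
next
  case (4 x xs y ys)
  then obtain \<rho> where \<rho>: "\<rho> permutes V" "map \<rho> xs = ys" by auto
  \<comment> \<open>The transposition corrects the image of \<open>x\<close>; neither of its two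
    points is an image already prescribed.\<close>
  define \<tau> where "\<tau> = Transposition.transpose (\<rho> x) y \<circ> \<rho>"
  have "\<rho> x \<in> V" using \<rho>(1) 4 by (simp add: permutes_in_image)
  then have \<tau>: "\<tau> permutes V"
    unfolding \<tau>_def using 4 \<rho>(1) by (intro permutes_compose permutes_swap_id) auto
  have "\<rho> z \<noteq> \<rho> x" "\<rho> z \<noteq> y" if "z \<in> set xs" for z
    using that 4 \<rho> by (auto dest: permutes_inj simp: inj_eq)
  then have "map \<tau> xs = map \<rho> xs"
    by (simp add: \<tau>_def Transposition.transpose_def)
  moreover have "\<tau> x = y" by (simp add: \<tau>_def)
  ultimately show ?case using \<tau> \<rho>(2) by (intro exI[of _ \<tau>]) simp
qed auto

lemma permutes_image_set:
  assumes "finite A" "finite B" "card A = card B" "A \<subseteq> V" "B \<subseteq> V"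
  shows "\<exists>\<rho>. \<rho> permutes V \<and> \<rho> ` A = B"
proof -
  obtain xs ys where "set xs = A" "distinct xs" "set ys = B" "distinct ys"
    using assms finite_distinct_list by metis
  then show ?thesis
    using permutes_map_list[of xs ys V] assms by (auto simp flip: distinct_card set_map)
qed

lemma permutes_image_ksubsets:
  assumes "\<pi> permutes V"
  shows "\<pi> ` e \<in> ksubsets V k \<longleftrightarrow> e \<in> ksubsets V k"
proof -
  have "inj \<pi>" using assms by (rule permutes_inj)
  moreover have "\<pi> ` e \<subseteq> V \<longleftrightarrow> e \<subseteq> V"
    using assms by (auto simp: permutes_in_image)
  ultimately show ?thesis
    by (simp add: ksubsets_def card_image inj_on_subset)
qed

lemma sum_ksubsets_permute:
  assumes "\<pi> permutes V"
  shows "(\<Sum>e\<in>ksubsets V k. F (\<pi> ` e)) = (\<Sum>e\<in>ksubsets V k. F e)"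
proof (rule sum.reindex_bij_witness[where i = "\<lambda>e. inv \<pi> ` e" and j = "\<lambda>e. \<pi> ` e"])
qed (use assms permutes_image_ksubsets[OF permutes_inv[OF assms]] in
    \<open>auto simp: permutes_image_ksubsets image_image permutes_inverses\<close>)

text \<open>By transitivity on k-sets the sum does not depend on \<open>e\<close>, and its total
  over all \<open>e\<close> is a multiple of the total weight.\<close>

lemma perm_sum_eq_0:
  assumes V: "finite V" and w: "(\<Sum>e\<in>ksubsets V k. w e) = 0" and e: "e \<in> ksubsets V k"
  shows "(\<Sum>\<pi> | \<pi> permutes V. w (\<pi> ` e)) = (0::real)"
proof -
  have "(\<Sum>\<pi> | \<pi> permutes V. w (\<pi> ` f)) = (\<Sum>\<pi> | \<pi> permutes V. w (\<pi> ` e))"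
    if f: "f \<in> ksubsets V k" for f
  proof -
    have "finite e" "finite f" "card e = card f" "e \<subseteq> V" "f \<subseteq> V"
      using e f V finite_subset by (auto simp: ksubsets_def)
    then obtain \<rho> where "\<rho> permutes V" "\<rho> ` e = f"
      using permutes_image_set by metis
    then show ?thesis
      using sum_permutations_compose_right[of \<rho> V "\<lambda>\<pi>. w (\<pi> ` e)"]
      by (simp only: image_comp[symmetric])
  qed
  then have "card (ksubsets V k) * (\<Sum>\<pi> | \<pi> permutes V. w (\<pi> ` e))
      = (\<Sum>f\<in>ksubsets V k. \<Sum>\<pi> | \<pi> permutes V. w (\<pi> ` f))"
    by simp
  also have "\<dots> = (\<Sum>\<pi> | \<pi> permutes V. \<Sum>f\<in>ksubsets V k. w f)"
    by (subst sum.swap) (simp add: sum_ksubsets_permute[of _ V w])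
  also have "\<dots> = 0" using w by simp
  finally show ?thesis using e V by auto
qed

text \<open>Equal to \<open>hinner\<close> for \<open>hperm (inv \<pi>) w\<close>, so it takes the
  same values over all permutations. Without the inverse, exchanges act by composition on the
  right.\<close>

definition overlap :: "'a set \<Rightarrow> nat \<Rightarrow> ('a set \<Rightarrow> real) \<Rightarrow> ('a set \<Rightarrow> real) \<Rightarrow> ('a \<Rightarrow> 'a) \<Rightarrow> real" where
  "overlap V k w u \<pi> = (\<Sum>e\<in>ksubsets V k. w (\<pi> ` e) * u e)"

lemma perm_avg_overlap:
  assumes "finite V" "(\<Sum>e\<in>ksubsets V k. w e) = 0"
  shows "perm_avg V (overlap V k w u) = 0"
proof -
  have "perm_avg V (overlap V k w u) = (\<Sum>e\<in>ksubsets V k. (\<Sum>\<pi> | \<pi> permutes V. w (\<pi> ` e)) * u e) / fact (card V)"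
    unfolding perm_avg_def overlap_def sum_distrib_right by (subst sum.swap) rule
  also have "\<dots> = 0" using perm_sum_eq_0[OF assms] by simp
  finally show ?thesis .
qed

section \<open>Exchanges of disjoint pairs and the functions they negate\<close>

locale pairing =
  fixes I :: "'i set" and x y :: "'i \<Rightarrow> 'a"
  assumes finite_I: "finite I"
    and inj_x: "inj_on x I" and inj_y: "inj_on y I"
    and disjoint_xy: "x ` I \<inter> y ` I = {}"
begin

text \<open>Exchanging the members of the pairs in \<open>S\<close> embeds the discrete cube into the symmetric group.\<close>

definition swp :: "'i set \<Rightarrow> 'a \<Rightarrow> 'a" where
  "swp S v = (if v \<in> x ` S then y (inv_into I x v)
     else if v \<in> y ` S then x (inv_into I y v) else v)"

definition pts :: "'i set \<Rightarrow> 'a set" where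
  "pts T = x ` T \<union> y ` T"

text \<open>The alternating sign of the pairs in \<open>T\<close>, indexed by a set so that it
  corresponds to the Walsh function of \<open>T\<close>.\<close>

definition psi :: "'i set \<Rightarrow> 'a set \<Rightarrow> real" where
  "psi T e = (\<Prod>s\<in>T. pair_sign (x s, y s) e)"

lemma x_eq_iff [simp]: "s \<in> I \<Longrightarrow> t \<in> I \<Longrightarrow> x s = x t \<longleftrightarrow> s = t"
  using inj_x by (auto simp: inj_on_def)

lemma y_eq_iff [simp]: "s \<in> I \<Longrightarrow> t \<in> I \<Longrightarrow> y s = y t \<longleftrightarrow> s = t"
  using inj_y by (auto simp: inj_on_def)

lemma x_neq_y [simp]: "s \<in> I \<Longrightarrow> t \<in> I \<Longrightarrow> x s \<noteq> y t" "s \<in> I \<Longrightarrow> t \<in> I \<Longrightarrow> y t \<noteq> x s"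
  using disjoint_xy by auto

lemma x_mem_iff [simp]: "s \<in> I \<Longrightarrow> S \<subseteq> I \<Longrightarrow> x s \<in> x ` S \<longleftrightarrow> s \<in> S"
  using inj_x by (auto simp: inj_on_def)

lemma y_mem_iff [simp]: "s \<in> I \<Longrightarrow> S \<subseteq> I \<Longrightarrow> y s \<in> y ` S \<longleftrightarrow> s \<in> S"
  using inj_y by (auto simp: inj_on_def)

lemma xy_mem_iff [simp]: "s \<in> I \<Longrightarrow> S \<subseteq> I \<Longrightarrow> x s \<notin> y ` S" "s \<in> I \<Longrightarrow> S \<subseteq> I \<Longrightarrow> y s \<notin> x ` S"
  using disjoint_xy by auto

lemma pts_mem_iff [simp]:
  "s \<in> I \<Longrightarrow> S \<subseteq> I \<Longrightarrow> x s \<in> pts S \<longleftrightarrow> s \<in> S" "s \<in> I \<Longrightarrow> S \<subseteq> I \<Longrightarrow> y s \<in> pts S \<longleftrightarrow> s \<in> S"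
  by (auto simp: pts_def)

lemma pts_cases:
  assumes "v \<in> pts S" obtains s where "s \<in> S" "v = x s" | s where "s \<in> S" "v = y s"
  using assms by (auto simp: pts_def)

lemma swp_x [simp]: "s \<in> I \<Longrightarrow> S \<subseteq> I \<Longrightarrow> swp S (x s) = (if s \<in> S then y s else x s)"
  by (simp add: swp_def inv_into_f_f[OF inj_x])

lemma swp_y [simp]: "s \<in> I \<Longrightarrow> S \<subseteq> I \<Longrightarrow> swp S (y s) = (if s \<in> S then x s else y s)"
  by (simp add: swp_def inv_into_f_f[OF inj_y])

lemma swp_other: "v \<notin> pts S \<Longrightarrow> swp S v = v"
  by (simp add: swp_def pts_def)

lemma pts_mono: "S \<subseteq> T \<Longrightarrow> pts S \<subseteq> pts T"
  by (auto simp: pts_def)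

lemma fun_eqI:
  assumes "\<And>s. s \<in> I \<Longrightarrow> f (x s) = g (x s)" "\<And>s. s \<in> I \<Longrightarrow> f (y s) = g (y s)"
    and "\<And>v. v \<notin> pts I \<Longrightarrow> f v = g v"
  shows "f = g"
proof
  fix v
  show "f v = g v"
  proof (cases "v \<in> pts I")
    case True
    then show ?thesis by (cases rule: pts_cases) (use assms(1,2) in auto)
  qed (rule assms(3))
qed

lemma swp_not_pts [simp]: "v \<notin> pts I \<Longrightarrow> S \<subseteq> I \<Longrightarrow> swp S v = v"
  using pts_mono[of S I] by (intro swp_other) auto

lemma swp_Un: "S \<subseteq> I \<Longrightarrow> R \<subseteq> I \<Longrightarrow> S \<inter> R = {} \<Longrightarrow> swp (S \<union> R) = swp S \<circ> swp R"
  by (rule fun_eqI) auto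

lemma swp_swp: "S \<subseteq> I \<Longrightarrow> swp S (swp S v) = v"
  using fun_eqI[of "swp S \<circ> swp S" id] by (auto simp: fun_eq_iff)

lemma swp_toggle:
  assumes "S \<subseteq> I" "s \<in> I"
  shows "swp (if s \<in> S then S - {s} else insert s S) = swp S \<circ> swp {s}"
proof (cases "s \<in> S")
  case True
  have "swp ((S - {s}) \<union> {s}) = swp (S - {s}) \<circ> swp {s}"
    using assms by (intro swp_Un) auto
  then have "swp S = swp (S - {s}) \<circ> swp {s}"
    using True by (simp add: insert_absorb)
  moreover have "swp {s} \<circ> swp {s} = id"
    using assms by (simp add: fun_eq_iff swp_swp)
  ultimately show ?thesis using True by (simp add: comp_assoc)
next
  case False
  then have "swp (S \<union> {s}) = swp S \<circ> swp {s}"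
    using assms by (intro swp_Un) auto
  then show ?thesis using False by simp
qed

lemma swp_empty [simp]: "swp {} = id"
  by (auto simp: swp_def)

lemma swp_permutes_pts:
  assumes "S \<subseteq> I"
  shows "swp S permutes pts S"
  unfolding permutes_def
proof (intro conjI allI impI)
  fix v
  show "\<exists>!u. swp S u = v"
    by (rule ex1I[of _ "swp S v"]) (auto simp: swp_swp[OF assms])
qed (rule swp_other)

lemma swp_permutes:
  assumes "S \<subseteq> I" "pts I \<subseteq> V"
  shows "swp S permutes V"
  using swp_permutes_pts[OF assms(1)] subset_trans[OF pts_mono[OF assms(1)] assms(2)]
  by (rule permutes_subset)

lemma mem_swp_image: "S \<subseteq> I \<Longrightarrow> v \<in> swp S ` e \<longleftrightarrow> swp S v \<in> e"
  by (auto simp: swp_swp intro: image_eqI[of v "swp S" "swp S v"])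

text \<open>Exchanging a pair in \<open>T\<close> negates exactly one factor, so the exchanges act
  on \<open>psi T\<close> through the Walsh character of \<open>T\<close>.\<close>

lemma psi_swp:
  assumes "S \<subseteq> I" "T \<subseteq> I"
  shows "psi T (swp S ` e) = walsh T S * psi T e"
proof -
  have "pair_sign (x s, y s) (swp S ` e) = (if s \<in> S then - 1 else 1) * pair_sign (x s, y s) e"
    if "s \<in> T" for s
  proof -
    have "s \<in> I" using that assms by auto
    then show ?thesis using assms(1) by (simp add: pair_sign_def mem_swp_image)
  qed
  then show ?thesis
    using walsh_eq_prod[OF finite_subset[OF assms(2) finite_I]] by (simp add: psi_def prod.distrib)
qed

lemma psi_permute:
  assumes "\<rho> permutes (V - pts T)"
  shows "psi T (\<rho> ` e) = psi T e"
proof -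
  have "v \<in> \<rho> ` e \<longleftrightarrow> v \<in> e" if "v \<in> pts T" for v
  proof -
    have "\<rho> v = v" using that assms by (auto simp: permutes_def)
    then show ?thesis using permutes_inj[OF assms] by (metis inj_image_mem_iff)
  qed
  then show ?thesis
    unfolding psi_def pair_sign_def by (intro prod.cong) (auto simp: pts_def)
qed

lemma psi_nonzero_iff:
  assumes "T \<subseteq> I"
  shows "psi T e \<noteq> 0 \<longleftrightarrow> (\<forall>s\<in>T. x s \<in> e \<longleftrightarrow> y s \<notin> e)"
  using finite_subset[OF assms finite_I] by (simp add: psi_def pair_sign_def of_bool_def) blast

lemma abs_psi_le_1: "\<bar>psi T e\<bar> \<le> 1"
  unfolding psi_def abs_prod by (intro prod_le_1) (auto simp: pair_sign_def)

lemma card_psi_nonzero: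
  assumes "T \<subseteq> I" "psi T e \<noteq> 0"
  shows "card (e \<inter> pts T) = card T"
proof -
  have iff: "x s \<in> e \<longleftrightarrow> y s \<notin> e" if "s \<in> T" for s
    using assms that psi_nonzero_iff by auto
  have "e \<inter> pts T = (\<lambda>s. if x s \<in> e then x s else y s) ` T"
    using iff by (auto simp: pts_def image_iff split: if_splits)
  moreover have "inj_on (\<lambda>s. if x s \<in> e then x s else y s) T"
    using assms by (auto simp: inj_on_def subset_iff split: if_splits)
  ultimately show ?thesis by (simp only: card_image)
qed

text \<open>Both sets meet each pair of \<open>T\<close> in one vertex and have equally many
  vertices elsewhere. \<open>S\<close> collects the pairs where the choices differ and
  \<open>\<rho>\<close> matches the rest, so the k-sets in the support of \<open>psi T\<close> form
  one orbit.\<close>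

lemma psi_orbit:
  assumes V: "finite V" and T: "T \<subseteq> I" "pts T \<subseteq> V"
    and e: "e \<in> ksubsets V k" "psi T e \<noteq> 0" and e': "e' \<in> ksubsets V k" "psi T e' \<noteq> 0"
  shows "\<exists>S \<rho>. S \<subseteq> T \<and> \<rho> permutes (V - pts T) \<and> e' = swp S ` \<rho> ` e"
proof -
  have sub: "e \<subseteq> V" "e' \<subseteq> V" "card e = k" "card e' = k" using e e' by (auto simp: ksubsets_def)
  have fin: "finite e" "finite e'" using sub V finite_subset by auto
  have "card (e - pts T) = k - card T" "card (e' - pts T) = k - card T"
    using card_psi_nonzero[OF T(1)] e(2) e'(2) sub fin by (simp_all add: card_Diff_subset_Int)
  then obtain \<rho> where \<rho>: "\<rho> permutes (V - pts T)" "\<rho> ` (e - pts T) = e' - pts T"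
    using permutes_image_set[of "e - pts T" "e' - pts T" "V - pts T"] fin sub by auto
  define S where "S = {s \<in> T. (x s \<in> e) \<noteq> (x s \<in> e')}"
  have S: "S \<subseteq> I" "S \<subseteq> T" using T by (auto simp: S_def)
  have fixed: "\<rho> v = v" if "v \<in> pts T" for v
    using that \<rho>(1) by (auto simp: permutes_def)
  have pt: "v \<in> \<rho> ` e \<longleftrightarrow> v \<in> e" if "v \<in> pts T" for v
    using fixed[OF that] permutes_inj[OF \<rho>(1)] by (metis inj_image_mem_iff)
  have other: "v \<in> \<rho> ` e \<longleftrightarrow> v \<in> e'" if "v \<notin> pts T" for v
  proof -
    have "z \<notin> pts T" if "v = \<rho> z" for z
      using that fixed[of z] \<open>v \<notin> pts T\<close> by auto
    then have "v \<in> \<rho> ` e \<longleftrightarrow> v \<in> \<rho> ` (e - pts T)"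
      by blast
    then show ?thesis using \<rho>(2) that by simp
  qed
  have iff: "x s \<in> e \<longleftrightarrow> y s \<notin> e" "x s \<in> e' \<longleftrightarrow> y s \<notin> e'" if "s \<in> T" for s
    using e(2) e'(2) that psi_nonzero_iff[OF T(1)] by auto
  have "v \<in> swp S ` \<rho> ` e \<longleftrightarrow> v \<in> e'" for v
  proof (cases "v \<in> pts T")
    case True
    then show ?thesis
    proof (cases rule: pts_cases)
      case (1 s)
      then have "s \<in> I" using T by auto
      then show ?thesis using 1 iff[of s] pt T(1)
        by (simp add: mem_swp_image[OF S(1)] S(1)) (auto simp: S_def)
    next
      case (2 s)
      then have "s \<in> I" using T by auto
      then show ?thesis using 2 iff[of s] pt T(1)
        by (simp add: mem_swp_image[OF S(1)] S(1)) (auto simp: S_def)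
    qed
  next
    case False
    then have "swp S v = v" using pts_mono[OF S(2)] by (intro swp_other) auto
    then show ?thesis using False other by (simp add: mem_swp_image[OF S(1)])
  qed
  then have "e' = swp S ` \<rho> ` e" by blast
  then show ?thesis using S \<rho> by blast
qed

text \<open>The functions that change sign under every exchange of a pair in \<open>T\<close> and are invariant
  under permutations of the remaining vertices form a line, spanned by \<open>psi T\<close>.\<close>

lemma psi_unique:
  assumes V: "finite V" and T: "T \<subseteq> I" "pts T \<subseteq> V"
    and anti: "\<And>s e. s \<in> T \<Longrightarrow> h (swp {s} ` e) = - h e"
    and inv: "\<And>\<rho> e. \<rho> permutes (V - pts T) \<Longrightarrow> h (\<rho> ` e) = h e"
    and e: "e \<in> ksubsets V k" and e0: "e0 \<in> ksubsets V k"
  shows "h e * psi T e0 = h e0 * psi T e"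
proof -
  \<comment> \<open>Outside the support of \<open>psi T\<close> some pair has both or neither vertex
    in \<open>f\<close>; its exchange fixes \<open>f\<close> but negates \<open>h f\<close>.\<close>
  have zero: "h f = 0" if f: "psi T f = 0" for f
  proof -
    obtain s where s: "s \<in> T" "x s \<in> f \<longleftrightarrow> y s \<in> f"
      using f psi_nonzero_iff[OF T(1), of f] by auto
    then have "s \<in> I" using T by auto
    have "v \<in> swp {s} ` f \<longleftrightarrow> v \<in> f" for v
    proof (cases "v \<in> pts {s}")
      case True
      then show ?thesis
        using s(2) \<open>s \<in> I\<close> by (auto simp: mem_swp_image pts_def)
    qed (use \<open>s \<in> I\<close> in \<open>simp add: mem_swp_image swp_other\<close>)
    then have "swp {s} ` f = f" by blast
    then show ?thesis using anti[OF s(1), of f] by simp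
  qed
  have walsh: "h (swp S ` f) = walsh T S * h f" if "S \<subseteq> T" for S f
  proof -
    have "finite S" using subset_trans[OF that T(1)] finite_I by (rule finite_subset)
    then show ?thesis using that
    proof (induction S arbitrary: f rule: finite_induct)
      case empty
      then show ?case by (simp add: walsh_def)
    next
      case (insert s S)
      then have "swp (insert s S) ` f = swp {s} ` swp S ` f"
        using swp_Un[of "{s}" S] insert T(1) by (simp add: image_comp subset_iff)
      then show ?case
        using insert anti by (simp add: walsh_insert)
    qed
  qed
  show ?thesis
  proof (cases "psi T e = 0 \<or> psi T e0 = 0")
    case True
    then show ?thesis using zero by auto
  next
    case False
    then obtain S \<rho> where "S \<subseteq> T" and \<rho>: "\<rho> permutes (V - pts T)" "e = swp S ` \<rho> ` e0"
      using psi_orbit[OF V T e0 _ e] by blast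
    then have "h e = walsh T S * h e0" "psi T e = walsh T S * psi T e0"
      using walsh inv psi_permute[of \<rho> V T] psi_swp[of S T] T(1) by auto
    then show ?thesis by simp
  qed
qed

lemma swp_split:
  assumes "S \<subseteq> I" "T \<subseteq> I"
  shows "swp S = swp (S - T) \<circ> swp (S \<inter> T)"
proof -
  have "swp ((S - T) \<union> (S \<inter> T)) = swp (S - T) \<circ> swp (S \<inter> T)"
    using assms by (intro swp_Un) auto
  then show ?thesis by (simp only: Un_Diff_Int)
qed

lemma swp_commute:
  assumes "S \<subseteq> T" "T \<subseteq> I" "\<rho> permutes (V - pts T)"
  shows "swp S \<circ> \<rho> = \<rho> \<circ> swp S"
proof
  fix v
  have swp: "swp S v = v" if "v \<notin> pts T" for v
    using that pts_mono[OF assms(1)] by (intro swp_other) auto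
  have fixed: "\<rho> v = v" if "v \<in> pts T" for v
    using that assms(3) by (auto simp: permutes_def)
  show "(swp S \<circ> \<rho>) v = (\<rho> \<circ> swp S) v"
  proof (cases "v \<in> pts T")
    case True
    have "swp S permutes pts T"
      using assms pts_mono swp_permutes_pts by (meson permutes_subset subset_trans)
    then have "swp S v \<in> pts T" using True by (simp add: permutes_in_image)
    then show ?thesis using True fixed by simp
  next
    case False
    then have "\<rho> v \<notin> pts T"
      using fixed permutes_inj[OF assms(3)] by (metis injD)
    then show ?thesis using False swp by simp
  qed
qed

text \<open>Averaging the coefficient over the group \<open>G\<close> of permutations fixing the
  vertices of \<open>T\<close> projects the placed weighting onto the line of \<open>psi T\<close>.
  The average thus equals the product of the alternating sums of \<open>u\<close> and of the placed
  \<open>w\<close>, divided by the square norm of \<open>psi T\<close>. The triangle inequality and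
  invariance of the average over \<open>\<pi>\<close> then remove \<open>G\<close>.\<close>

lemma perm_avg_fourier_ge:
  fixes w u :: "'a set \<Rightarrow> real"
  assumes V: "finite V" "pts I \<subseteq> V" and T: "T \<subseteq> I"
  shows "\<bar>\<Sum>e\<in>ksubsets V k. u e * psi T e\<bar>
      * perm_avg V (\<lambda>\<pi>. \<bar>\<Sum>e\<in>ksubsets V k. w (\<pi> ` e) * psi T e\<bar>)
    \<le> (\<Sum>e\<in>ksubsets V k. (psi T e)\<^sup>2)
      * perm_avg V (\<lambda>\<pi>. \<bar>fourier I (\<lambda>S. overlap V k w u (\<pi> \<circ> swp S)) T\<bar>)"
proof -
  define E where "E = ksubsets V k"
  define G where "G = {\<rho>. \<rho> permutes (V - pts T)}"
  define a where "a \<pi> = fourier I (\<lambda>S. overlap V k w u (\<pi> \<circ> swp S)) T" for \<pi>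
  have finG: "finite G" "card G > 0"
    using V finite_permutations[of "V - pts T"] card_permutations[of "V - pts T" "card (V - pts T)"]
    by (auto simp: G_def)
  have ptsT: "pts T \<subseteq> V" using V(2) pts_mono[OF T] by auto
  have GV: "\<rho> permutes V" if "\<rho> \<in> G" for \<rho>
    using that unfolding G_def by (auto intro: permutes_subset)
  have absorb: "(\<Sum>\<rho>\<in>G. F (\<rho> \<circ> \<kappa>)) = (\<Sum>\<rho>\<in>G. F \<rho>)" if "\<kappa> \<in> G" for F :: "('a \<Rightarrow> 'a) \<Rightarrow> real" and \<kappa>
    using sum_permutations_compose_right[of \<kappa> "V - pts T" F] that by (simp add: G_def)
  have key: "(\<Sum>e\<in>E. (psi T e)\<^sup>2) * (\<Sum>\<rho>\<in>G. a (\<pi> \<circ> \<rho>))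
      = real (card G) * (\<Sum>e\<in>E. u e * psi T e) * (\<Sum>e\<in>E. w (\<pi> ` e) * psi T e)" for \<pi>
  proof -
    \<comment> \<open>The projection of the placed \<open>w\<close>, up to a factor: signed sum over
      exchanges and plain sum over \<open>G\<close>.\<close>
    define h where "h e = (\<Sum>S\<in>Pow I. walsh T S * (\<Sum>\<rho>\<in>G. w ((\<pi> \<circ> \<rho> \<circ> swp S) ` e)))" for e
    have a_h: "2 ^ card I * (\<Sum>\<rho>\<in>G. a (\<pi> \<circ> \<rho>)) = (\<Sum>e\<in>E. u e * h e)"
    proof -
      have "2 ^ card I * (\<Sum>\<rho>\<in>G. a (\<pi> \<circ> \<rho>))
        = (\<Sum>\<rho>\<in>G. \<Sum>S\<in>Pow I. \<Sum>e\<in>E. walsh T S * (w ((\<pi> \<circ> \<rho> \<circ> swp S) ` e) * u e))"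
      proof -
        have "2 ^ card I * a (\<pi> \<circ> \<rho>)
            = (\<Sum>S\<in>Pow I. \<Sum>e\<in>E. walsh T S * (w ((\<pi> \<circ> \<rho> \<circ> swp S) ` e) * u e))" for \<rho>
          by (simp only: a_def fourier_def cube_avg_def overlap_def E_def sum_distrib_left) simp
        then show ?thesis by (simp only: sum_distrib_left)
      qed
      also have "\<dots> = (\<Sum>e\<in>E. \<Sum>S\<in>Pow I. \<Sum>\<rho>\<in>G. walsh T S * (w ((\<pi> \<circ> \<rho> \<circ> swp S) ` e) * u e))"
        by (rule sum_swap3)
      also have "\<dots> = (\<Sum>e\<in>E. u e * h e)"
        unfolding h_def sum_distrib_left by (intro sum.cong refl) (simp add: mult_ac)
      finally show ?thesis .
    qed
    \<comment> \<open>Exchanges of pairs outside \<open>T\<close> belong to \<open>G\<close> and are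
      absorbed by the sum over \<open>G\<close>; those inside \<open>T\<close> commute with
      \<open>\<rho>'\<close>.\<close>
    have inv: "h (\<rho>' ` e) = h e" if \<rho>': "\<rho>' permutes (V - pts T)" for \<rho>' e
      unfolding h_def
    proof (rule sum.cong[OF refl])
      fix S assume "S \<in> Pow I"
      then have S: "S \<subseteq> I" by simp
      have "pts (S - T) \<subseteq> V - pts T"
      proof
        fix v assume v: "v \<in> pts (S - T)"
        then obtain s where "s \<in> S" "s \<notin> T" "v = x s \<or> v = y s"
          by (auto elim: pts_cases)
        then have "v \<notin> pts T" "v \<in> pts I" using S T by auto
        then show "v \<in> V - pts T" using V(2) by auto
      qed
      then have ST: "swp (S - T) \<in> G"
        using S swp_permutes_pts[of "S - T"] permutes_subset unfolding G_def by blast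
      then have ST': "swp (S - T) \<circ> \<rho>' \<in> G"
        using \<rho>' by (auto simp: G_def intro: permutes_compose)
      have "swp S \<circ> \<rho>' = (swp (S - T) \<circ> \<rho>') \<circ> swp (S \<inter> T)"
        using swp_commute[of "S \<inter> T" T \<rho>' V] T \<rho>' by (subst swp_split[OF S T]) (simp add: comp_assoc)
      then have "(\<pi> \<circ> \<rho> \<circ> swp S) \<circ> \<rho>' = \<pi> \<circ> (\<rho> \<circ> (swp (S - T) \<circ> \<rho>')) \<circ> swp (S \<inter> T)" for \<rho>
        by (simp only: comp_assoc)
      then have "(\<Sum>\<rho>\<in>G. w ((\<pi> \<circ> \<rho> \<circ> swp S) ` \<rho>' ` e))
          = (\<Sum>\<rho>\<in>G. w ((\<pi> \<circ> (\<rho> \<circ> (swp (S - T) \<circ> \<rho>')) \<circ> swp (S \<inter> T)) ` e))"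
        by (simp only: image_comp)
      also have "\<dots> = (\<Sum>\<rho>\<in>G. w ((\<pi> \<circ> (\<rho> \<circ> swp (S - T)) \<circ> swp (S \<inter> T)) ` e))"
        using absorb[OF ST', of "\<lambda>\<rho>. w ((\<pi> \<circ> \<rho> \<circ> swp (S \<inter> T)) ` e)"]
          absorb[OF ST, of "\<lambda>\<rho>. w ((\<pi> \<circ> \<rho> \<circ> swp (S \<inter> T)) ` e)"] by simp
      also have "\<dots> = (\<Sum>\<rho>\<in>G. w ((\<pi> \<circ> \<rho> \<circ> swp S) ` e))"
        by (simp only: swp_split[OF S T, symmetric] comp_assoc)
      finally show "walsh T S * (\<Sum>\<rho>\<in>G. w ((\<pi> \<circ> \<rho> \<circ> swp S) ` \<rho>' ` e))
          = walsh T S * (\<Sum>\<rho>\<in>G. w ((\<pi> \<circ> \<rho> \<circ> swp S) ` e))"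
        by (simp only:)
    qed
    have anti: "h (swp {s} ` e) = - h e" if s: "s \<in> T" for s e
    proof -
      let ?W = "\<lambda>S. \<Sum>\<rho>\<in>G. w ((\<pi> \<circ> \<rho> \<circ> swp S) ` e)"
      let ?t = "\<lambda>S. if s \<in> S then S - {s} else insert s S"
      have sI: "s \<in> I" using s T by auto
      have "h (swp {s} ` e) = (\<Sum>S\<in>Pow I. - (walsh T (?t S) * ?W (?t S)))"
        unfolding h_def
      proof (intro sum.cong refl)
        fix S assume S: "S \<in> Pow I"
        then have "finite S" using finite_I finite_subset by auto
        moreover have "(\<pi> \<circ> \<rho> \<circ> swp S) ` swp {s} ` e = (\<pi> \<circ> \<rho> \<circ> swp (?t S)) ` e" for \<rho>
        proof -
          have "swp (?t S) = swp S \<circ> swp {s}"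
            using S sI by (intro swp_toggle) auto
          then show ?thesis by (simp only: image_comp comp_assoc)
        qed
        ultimately show "walsh T S * (\<Sum>\<rho>\<in>G. w ((\<pi> \<circ> \<rho> \<circ> swp S) ` swp {s} ` e))
            = - (walsh T (?t S) * ?W (?t S))"
          by (simp only: walsh_toggle[OF _ s])
      qed
      also have "\<dots> = - h e"
        unfolding sum_negf h_def using sum_toggle[OF sI, of "\<lambda>S. walsh T S * ?W S"] by simp
      finally show ?thesis .
    qed
    have h_psi: "(\<Sum>e\<in>E. h e * psi T e) = 2 ^ card I * real (card G) * (\<Sum>e\<in>E. w (\<pi> ` e) * psi T e)"
    proof -
      have "(\<Sum>e\<in>E. h e * psi T e)
          = (\<Sum>S\<in>Pow I. \<Sum>\<rho>\<in>G. \<Sum>e\<in>E. walsh T S * w ((\<pi> \<circ> \<rho> \<circ> swp S) ` e) * psi T e)"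
        unfolding h_def sum_distrib_right sum_distrib_left sum_swap3[of _ G] by (rule sum.swap)
      also have "\<dots> = (\<Sum>S\<in>Pow I. \<Sum>\<rho>\<in>G. \<Sum>e\<in>E. w (\<pi> ` e) * psi T e)"
      proof (rule sum.cong[OF refl], rule sum.cong[OF refl])
        fix S \<rho> assume "S \<in> Pow I" and \<rho>: "\<rho> \<in> G"
        then have S: "S \<subseteq> I" by simp
        have perm: "\<rho> \<circ> swp S permutes V"
          using GV[OF \<rho>] swp_permutes[OF S V(2)] by (intro permutes_compose)
        have "walsh T S * walsh T S = 1"
          by (simp add: walsh_def flip: power_add)
        moreover have "psi T ((\<rho> \<circ> swp S) ` e) = walsh T S * psi T e" for e
          using \<rho> psi_permute[of \<rho> V T "swp S ` e"] psi_swp[OF S T, of e]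
          by (simp only: G_def image_comp[symmetric] mem_Collect_eq)
        ultimately have "walsh T S * w ((\<pi> \<circ> \<rho> \<circ> swp S) ` e) * psi T e
            = w (\<pi> ` (\<rho> \<circ> swp S) ` e) * psi T ((\<rho> \<circ> swp S) ` e)" for e
          by (simp only: image_comp comp_assoc mult_ac)
        then show "(\<Sum>e\<in>E. walsh T S * w ((\<pi> \<circ> \<rho> \<circ> swp S) ` e) * psi T e) = (\<Sum>e\<in>E. w (\<pi> ` e) * psi T e)"
          using sum_ksubsets_permute[OF perm, of "\<lambda>e. w (\<pi> ` e) * psi T e" k] by (simp add: E_def)
      qed
      finally show ?thesis using finite_I by (simp add: card_Pow)
    qed
    \<comment> \<open>Cross multiplication instead of division keeps the identity valid where
      \<open>psi T\<close> vanishes.\<close>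
    have ratio: "h e * psi T e' = h e' * psi T e" if "e \<in> E" "e' \<in> E" for e e'
      using that unfolding E_def by (intro psi_unique[OF V(1) T ptsT anti inv])
    have "(\<Sum>e\<in>E. (psi T e)\<^sup>2) * (\<Sum>e\<in>E. u e * h e)
        = (\<Sum>e\<in>E. \<Sum>e'\<in>E. (psi T e * u e') * (h e' * psi T e))"
      unfolding sum_product by (simp add: power2_eq_square mult_ac)
    also have "\<dots> = (\<Sum>e\<in>E. \<Sum>e'\<in>E. (psi T e * u e') * (h e * psi T e'))"
      using ratio by (intro sum.cong refl) simp
    also have "\<dots> = (\<Sum>e\<in>E. h e * psi T e) * (\<Sum>e\<in>E. u e * psi T e)"
      unfolding sum_product by (simp add: mult_ac)
    finally have "2 ^ card I * ((\<Sum>e\<in>E. (psi T e)\<^sup>2) * (\<Sum>\<rho>\<in>G. a (\<pi> \<circ> \<rho>)))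
        = 2 ^ card I * (real (card G) * (\<Sum>e\<in>E. u e * psi T e) * (\<Sum>e\<in>E. w (\<pi> ` e) * psi T e))"
      unfolding a_h[symmetric] h_psi by (simp only: mult_ac)
    then show ?thesis by simp
  qed
  have "card G * (\<bar>\<Sum>e\<in>E. u e * psi T e\<bar> * perm_avg V (\<lambda>\<pi>. \<bar>\<Sum>e\<in>E. w (\<pi> ` e) * psi T e\<bar>))
      = perm_avg V (\<lambda>\<pi>. (\<Sum>e\<in>E. (psi T e)\<^sup>2) * \<bar>\<Sum>\<rho>\<in>G. a (\<pi> \<circ> \<rho>)\<bar>)"
  proof -
    have "(\<Sum>e\<in>E. (psi T e)\<^sup>2) * \<bar>\<Sum>\<rho>\<in>G. a (\<pi> \<circ> \<rho>)\<bar>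
        = card G * \<bar>\<Sum>e\<in>E. u e * psi T e\<bar> * \<bar>\<Sum>e\<in>E. w (\<pi> ` e) * psi T e\<bar>" for \<pi>
      using arg_cong[OF key, of abs \<pi>] by (simp add: abs_mult sum_nonneg)
    then show ?thesis by (simp add: perm_avg_mult mult.assoc)
  qed
  also have "\<dots> \<le> perm_avg V (\<lambda>\<pi>. (\<Sum>e\<in>E. (psi T e)\<^sup>2) * (\<Sum>\<rho>\<in>G. \<bar>a (\<pi> \<circ> \<rho>)\<bar>))"
    by (intro perm_avg_mono mult_left_mono sum_abs sum_nonneg) auto
  also have "\<dots> = (\<Sum>e\<in>E. (psi T e)\<^sup>2) * (\<Sum>\<rho>\<in>G. perm_avg V (\<lambda>\<pi>. \<bar>a (\<pi> \<circ> \<rho>)\<bar>))"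
    by (simp add: perm_avg_mult perm_avg_sum)
  also have "(\<Sum>\<rho>\<in>G. perm_avg V (\<lambda>\<pi>. \<bar>a (\<pi> \<circ> \<rho>)\<bar>)) = card G * perm_avg V (\<lambda>\<pi>. \<bar>a \<pi>\<bar>)"
    using perm_avg_compose[OF GV, of _ "\<lambda>\<pi>. \<bar>a \<pi>\<bar>"] by simp
  finally have "card G * (\<bar>\<Sum>e\<in>E. u e * psi T e\<bar> * perm_avg V (\<lambda>\<pi>. \<bar>\<Sum>e\<in>E. w (\<pi> ` e) * psi T e\<bar>))
      \<le> card G * ((\<Sum>e\<in>E. (psi T e)\<^sup>2) * perm_avg V (\<lambda>\<pi>. \<bar>a \<pi>\<bar>))"
    by (simp add: mult_ac)
  then show ?thesis using finG(2) by (simp add: E_def a_def)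
qed

text \<open>A k-set in the support of \<open>psi T\<close> is determined by its trace on the at most
  2j vertices of \<open>pts T\<close>, with at most 4^k possibilities, and its k - j other
  vertices.\<close>

lemma sum_psi_squared_le:
  assumes V: "finite V" "pts I \<subseteq> V" and T: "T \<subseteq> I" "card T = j" and j: "j \<le> k" "k \<le> card V"
  shows "(\<Sum>e\<in>ksubsets V k. (psi T e)\<^sup>2) \<le> 4 ^ k * real (card V) ^ (k - j)"
proof -
  define N where "N = {e \<in> ksubsets V k. psi T e \<noteq> 0}"
  have finT: "finite T" "finite (pts T)"
    using T(1) finite_I finite_subset by (auto simp: pts_def)
  have "(\<Sum>e\<in>ksubsets V k. (psi T e)\<^sup>2) = (\<Sum>e\<in>N. (psi T e)\<^sup>2)"
    unfolding N_def using V(1) by (intro sum.mono_neutral_right) auto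
  also have "\<dots> \<le> (\<Sum>e\<in>N. 1)"
    by (intro sum_mono) (metis abs_psi_le_1 abs_square_le_1)
  also have "\<dots> = real (card N)" by simp
  also have "card N \<le> card (Pow (pts T) \<times> ksubsets V (k - j))"
  proof (rule card_inj_on_le[of "\<lambda>e. (e \<inter> pts T, e - pts T)"])
    show "inj_on (\<lambda>e. (e \<inter> pts T, e - pts T)) N"
      by (rule inj_onI) blast
    show "(\<lambda>e. (e \<inter> pts T, e - pts T)) ` N \<subseteq> Pow (pts T) \<times> ksubsets V (k - j)"
    proof
      fix q assume "q \<in> (\<lambda>e. (e \<inter> pts T, e - pts T)) ` N"
      then obtain e where e: "e \<in> N" "q = (e \<inter> pts T, e - pts T)" by auto
      then have "e \<subseteq> V" "card e = k" "card (e \<inter> pts T) = j"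
        using card_psi_nonzero[OF T(1)] T(2) by (auto simp: N_def ksubsets_def)
      moreover have "finite e" using \<open>e \<subseteq> V\<close> V(1) finite_subset by auto
      ultimately show "q \<in> Pow (pts T) \<times> ksubsets V (k - j)"
        using e(2) by (auto simp: ksubsets_def card_Diff_subset_Int)
    qed
  qed (use V finT in auto)
  also have "real (card (Pow (pts T) \<times> ksubsets V (k - j))) \<le> 4 ^ k * real (card V) ^ (k - j)"
  proof -
    have "card (pts T) \<le> j + j"
      unfolding pts_def using card_Un_le[of "x ` T" "y ` T"] card_image_le[OF finT(1), of x]
        card_image_le[OF finT(1), of y] T(2) by linarith
    then have "(2::nat) ^ card (pts T) \<le> 2 ^ (2 * k)"
      using j by (intro power_increasing) auto
    moreover have "card V choose (k - j) \<le> card V ^ (k - j)"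
      using j by (intro binomial_le_pow) auto
    ultimately have "card (Pow (pts T) \<times> ksubsets V (k - j)) \<le> 4 ^ k * card V ^ (k - j)"
      using finT V(1) by (simp add: card_cartesian_product card_Pow card_ksubsets power_mult mult_mono)
    then have "real (card (Pow (pts T) \<times> ksubsets V (k - j))) \<le> real (4 ^ k * card V ^ (k - j))"
      by (rule of_nat_mono)
    then show ?thesis by simp
  qed
  finally show ?thesis by simp
qed

text \<open>A k-set meets at most k disjoint pairs, so it misses some pair of \<open>T\<close>.
  Exchanging this pair fixes the set, which therefore contributes nothing to the
  coefficient.\<close>

lemma fourier_overlap_eq_0:
  assumes V: "finite V" and A: "A \<subseteq> I" and T: "T \<subseteq> A" "k < card T"
  shows "fourier A (\<lambda>S. overlap V k w u (\<pi> \<circ> swp S)) T = 0"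
proof -
  have "fourier A (\<lambda>S. w ((\<pi> \<circ> swp S) ` e) * u e) T = 0" if e: "e \<in> ksubsets V k" for e
  proof -
    have fin: "finite e" "card e = k" using e V finite_subset by (auto simp: ksubsets_def)
    have "\<exists>s\<in>T. x s \<notin> e \<and> y s \<notin> e"
    proof (rule ccontr)
      assume "\<not> ?thesis"
      then have *: "x s \<in> e \<or> y s \<in> e" if "s \<in> T" for s using that by auto
      define g where "g s = (if x s \<in> e then x s else y s)" for s
      have "inj_on g T"
        using T(1) A by (auto simp: inj_on_def g_def subset_iff split: if_splits)
      moreover have "g ` T \<subseteq> e" using * by (auto simp: g_def)
      ultimately have "card T \<le> card e" using fin by (metis card_inj_on_le)
      then show False using T(2) fin by simp
    qed
    then obtain s where s: "s \<in> T" "x s \<notin> e" "y s \<notin> e" by auto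
    then have sI: "s \<in> I" "s \<in> A" using T A by auto
    have "swp {s} v = v" if "v \<in> e" for v
      using that s by (intro swp_other) (auto simp: pts_def)
    then have "swp {s} ` e = e" by simp
    then have "(\<pi> \<circ> swp (if s \<in> S then S - {s} else insert s S)) ` e = (\<pi> \<circ> swp S) ` e"
      if "S \<subseteq> A" for S
      by (simp only: swp_toggle[OF subset_trans[OF that A] sI(1)] image_comp[symmetric])
    then show ?thesis
      using s sI finite_subset[OF A finite_I] by (intro fourier_eq_0[of A s]) simp_all
  qed
  then show ?thesis unfolding overlap_def fourier_sum by simp
qed

end

section \<open>The slope of the biased overlap\<close>

lemma disjoint_pairs_iff:
  "ps \<in> disjoint_pairs j V \<longleftrightarrow> length ps = j \<and> distinct (map fst ps @ map snd ps)
    \<and> set (map fst ps @ map snd ps) \<subseteq> V"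
proof (induction j arbitrary: ps V)
  case 0
  then show ?case by auto
next
  case (Suc j)
  show ?case
  proof (cases ps)
    case (Cons p qs)
    have "ps \<in> disjoint_pairs (Suc j) V
        \<longleftrightarrow> p \<in> V \<times> V \<and> fst p \<noteq> snd p \<and> qs \<in> disjoint_pairs j (V - {fst p, snd p})"
      unfolding Cons disjoint_pairs.simps by blast
    also have "\<dots> \<longleftrightarrow> length ps = Suc j \<and> distinct (map fst ps @ map snd ps)
        \<and> set (map fst ps @ map snd ps) \<subseteq> V"
      unfolding Suc.IH Cons by (cases p) auto
    finally show ?thesis .
  qed auto
qed

lemma card_disjoint_pairs_le:
  assumes "finite V"
  shows "card (disjoint_pairs j V) \<le> card V ^ (2 * j)"
proof -
  have "disjoint_pairs j V \<subseteq> {ps. set ps \<subseteq> V \<times> V \<and> length ps = j}"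
  proof
    fix ps assume "ps \<in> disjoint_pairs j V"
    then have "length ps = j" "\<forall>p\<in>set ps. fst p \<in> V \<and> snd p \<in> V"
      by (auto simp: disjoint_pairs_iff)
    then show "ps \<in> {ps. set ps \<subseteq> V \<times> V \<and> length ps = j}" by auto
  qed
  then have "card (disjoint_pairs j V) \<le> card {ps. set ps \<subseteq> V \<times> V \<and> length ps = j}"
    using assms by (intro card_mono finite_lists_length_eq) auto
  also have "\<dots> = card V ^ (2 * j)"
    using assms by (simp add: card_lists_length_eq card_cartesian_product power_mult power2_eq_square)
  finally show ?thesis .
qed

lemma permute_disjoint_pairs:
  assumes "\<pi> permutes V" "ps \<in> disjoint_pairs j V"
  shows "map (map_prod \<pi> \<pi>) ps \<in> disjoint_pairs j V"
proof -
  have "map fst (map (map_prod \<pi> \<pi>) ps) @ map snd (map (map_prod \<pi> \<pi>) ps) = map \<pi> (map fst ps @ map snd ps)"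
    by simp
  moreover have "distinct (map \<pi> (map fst ps @ map snd ps))"
    using assms permutes_inj[OF assms(1)] unfolding disjoint_pairs_iff
    by (subst distinct_map) (auto intro: inj_on_subset)
  moreover have "set (map \<pi> (map fst ps @ map snd ps)) \<subseteq> V"
    using assms permutes_image[OF assms(1)] unfolding disjoint_pairs_iff set_map by blast
  ultimately show ?thesis
    using assms(2) unfolding disjoint_pairs_iff by simp
qed

lemma disjoint_pairs_transitive:
  assumes "ps \<in> disjoint_pairs j V" "qs \<in> disjoint_pairs j V"
  shows "\<exists>\<rho>. \<rho> permutes V \<and> map (map_prod \<rho> \<rho>) ps = qs"
proof -
  obtain \<rho> where \<rho>: "\<rho> permutes V" "map \<rho> (map fst ps @ map snd ps) = map fst qs @ map snd qs"
    using permutes_map_list[of "map fst ps @ map snd ps" "map fst qs @ map snd qs" V] assms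
    unfolding disjoint_pairs_iff by auto
  then have "map \<rho> (map fst ps) = map fst qs" "map \<rho> (map snd ps) = map snd qs"
    using assms unfolding disjoint_pairs_iff by auto
  then have "map fst (map (map_prod \<rho> \<rho>) ps) = map fst qs" "map snd (map (map_prod \<rho> \<rho>) ps) = map snd qs"
    by simp_all
  then have "map (map_prod \<rho> \<rho>) ps = qs"
    by (metis zip_map_fst_snd)
  then show ?thesis using \<rho>(1) by blast
qed

text \<open>By transitivity all fibres of the orbit map have equal size, so a random permutation
  carries \<open>ps\<close> to a uniform element among at most n^(2j) lists.\<close>

lemma sum_disjoint_pairs_le_perm_avg:
  fixes F :: "('a \<times> 'a) list \<Rightarrow> real"
  assumes V: "finite V" and ps: "ps \<in> disjoint_pairs j V" and F: "\<And>qs. 0 \<le> F qs"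
  shows "(\<Sum>qs\<in>disjoint_pairs j V. F qs)
    \<le> real (card V) ^ (2 * j) * perm_avg V (\<lambda>\<pi>. F (map (map_prod \<pi> \<pi>) ps))"
proof -
  define P where "P = {\<pi>. \<pi> permutes V}"
  define D where "D = disjoint_pairs j V"
  define g where "g = (\<lambda>\<pi> :: 'a \<Rightarrow> 'a. map (map_prod \<pi> \<pi>) ps)"
  define \<kappa> where "\<kappa> = card {\<pi> \<in> P. g \<pi> = ps}"
  have fin: "finite P" "finite D"
    using V finite_permutations by (auto simp: P_def D_def)
  have gD: "g ` P \<subseteq> D"
    using permute_disjoint_pairs[OF _ ps] by (auto simp: g_def P_def D_def)
  have fibre: "card {\<pi> \<in> P. g \<pi> = qs} = \<kappa>" if qs: "qs \<in> D" for qs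
  proof -
    obtain \<rho> where \<rho>: "\<rho> permutes V" "map (map_prod \<rho> \<rho>) ps = qs"
      using disjoint_pairs_transitive[OF ps] qs by (auto simp: D_def)
    have inv: "inv \<rho> \<circ> \<rho> = id" "\<rho> \<circ> inv \<rho> = id"
      using permutes_inv_o[OF \<rho>(1)] by auto
    have "map (map_prod (inv \<rho>) (inv \<rho>)) qs = ps"
      unfolding \<rho>(2)[symmetric] by (simp add: map_prod.comp inv map_prod.id)
    then show ?thesis
      unfolding \<kappa>_def using \<rho> permutes_inv[OF \<rho>(1)] inv
      by (intro bij_betw_same_card[OF bij_betw_byWitness[where f = "\<lambda>\<pi>. inv \<rho> \<circ> \<pi>" and f' = "\<lambda>\<pi>. \<rho> \<circ> \<pi>"]])
        (auto simp: P_def g_def o_assoc permutes_compose map_prod.comp[symmetric] simp flip: map_map)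
  qed
  have group: "(\<Sum>\<pi>\<in>P. H (g \<pi>)) = real \<kappa> * (\<Sum>qs\<in>D. H qs)" for H :: "('a \<times> 'a) list \<Rightarrow> real"
  proof -
    have "(\<Sum>\<pi>\<in>P. H (g \<pi>)) = (\<Sum>qs\<in>D. \<Sum>\<pi>\<in>{\<pi> \<in> P. g \<pi> = qs}. H (g \<pi>))"
      using sum.group[OF fin gD, of "\<lambda>\<pi>. H (g \<pi>)"] by simp
    also have "\<dots> = (\<Sum>qs\<in>D. real \<kappa> * H qs)"
      using fibre by (intro sum.cong refl) simp
    finally show ?thesis by (simp add: sum_distrib_left)
  qed
  have "real (card P) = real \<kappa> * real (card D)"
    using group[of "\<lambda>_. 1"] by simp
  moreover have "card P = fact (card V)"
    using V by (simp add: P_def card_permutations)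
  moreover have "real (card D) \<le> real (card V) ^ (2 * j)"
    using card_disjoint_pairs_le[OF V, of j] unfolding D_def of_nat_power[symmetric] by (rule of_nat_mono)
  ultimately have "fact (card V) \<le> real \<kappa> * real (card V) ^ (2 * j)"
    by (simp add: mult_left_mono)
  then have "fact (card V) * (\<Sum>qs\<in>D. F qs) \<le> (real \<kappa> * real (card V) ^ (2 * j)) * (\<Sum>qs\<in>D. F qs)"
    by (intro mult_right_mono sum_nonneg F)
  also have "\<dots> = real (card V) ^ (2 * j) * (\<Sum>\<pi>\<in>P. F (g \<pi>))"
    unfolding group by simp
  finally show ?thesis
    unfolding perm_avg_def D_def[symmetric] P_def[symmetric]
    by (simp add: g_def field_simps)
qed

lemma alt_sign_permute:
  assumes "inj \<pi>"
  shows "alt_sign (map (map_prod \<pi> \<pi>) ps) (\<pi> ` e) = alt_sign ps e"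
  using assms unfolding alt_sign_def by (simp add: pair_sign_def comp_def inj_image_mem_iff)

lemma alt_coeff_permute:
  assumes "\<pi> permutes V"
  shows "(\<Sum>e\<in>ksubsets V k. w (\<pi> ` e) * alt_sign ps e) = alt_coeff V k w (map (map_prod \<pi> \<pi>) ps)"
  using sum_ksubsets_permute[OF assms, of "\<lambda>e. w e * alt_sign (map (map_prod \<pi> \<pi>) ps) e" k]
  by (simp add: alt_coeff_def alt_sign_permute[OF permutes_inj[OF assms]])

lemma perm_avg_le_attained:
  assumes "finite V"
  shows "\<exists>\<pi>. \<pi> permutes V \<and> perm_avg V F \<le> F \<pi>"
proof (rule ccontr)
  assume "\<not> ?thesis"
  then have "(\<Sum>\<pi> | \<pi> permutes V. F \<pi>) < (\<Sum>\<pi> | \<pi> permutes V. perm_avg V F)"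
    using assms finite_permutations[of V] permutes_id[of V]
    by (intro sum_strict_mono) (auto simp: not_le simp del: permutes_id)
  also have "\<dots> = (\<Sum>\<pi> | \<pi> permutes V. F \<pi>)"
    using assms by (simp add: perm_avg_def card_permutations)
  finally show False by simp
qed

lemma fourier_cong:
  "(\<And>S. S \<subseteq> I \<Longrightarrow> f S = g S) \<Longrightarrow> fourier I f T = fourier I g T"
  unfolding fourier_def by (intro cube_avg_cong) simp

context pairing
begin

lemma psi_eq_alt_sign:
  assumes "distinct ss" "set ss = T"
  shows "psi T e = alt_sign (map (\<lambda>s. (x s, y s)) ss) e"
  unfolding psi_def alt_sign_def assms(2)[symmetric]
  by (simp add: prod.distinct_set_conv_list[OF assms(1)] comp_def)

lemma alt_norm_le_perm_avg:
  assumes V: "finite V" "pts I \<subseteq> V" and T: "T \<subseteq> I" "card T = j"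
  shows "alt_norm V k j w
    \<le> real (card V) ^ (2 * j) * perm_avg V (\<lambda>\<pi>. \<bar>\<Sum>e\<in>ksubsets V k. w (\<pi> ` e) * psi T e\<bar>)"
proof -
  obtain ss where ss: "set ss = T" "distinct ss"
    using finite_distinct_list[OF finite_subset[OF T(1) finite_I]] by auto
  define ps where "ps = map (\<lambda>s. (x s, y s)) ss"
  have "inj_on x T" "inj_on y T"
    using inj_x inj_y T(1) inj_on_subset by auto
  moreover have "x ` T \<inter> y ` T = {}"
    using disjoint_xy T(1) by blast
  moreover have "x ` T \<union> y ` T \<subseteq> V"
    using subset_trans[OF pts_mono[OF T(1)] V(2)] by (simp add: pts_def)
  moreover have "length ss = j"
    using ss T(2) distinct_card by metis
  ultimately have "ps \<in> disjoint_pairs j V"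
    using ss by (simp add: ps_def disjoint_pairs_iff distinct_map comp_def)
  then have "alt_norm V k j w
      \<le> real (card V) ^ (2 * j) * perm_avg V (\<lambda>\<pi>. \<bar>alt_coeff V k w (map (map_prod \<pi> \<pi>) ps)\<bar>)"
    unfolding alt_norm_def by (intro sum_disjoint_pairs_le_perm_avg V(1)) auto
  also have "perm_avg V (\<lambda>\<pi>. \<bar>alt_coeff V k w (map (map_prod \<pi> \<pi>) ps)\<bar>)
      = perm_avg V (\<lambda>\<pi>. \<bar>\<Sum>e\<in>ksubsets V k. w (\<pi> ` e) * psi T e\<bar>)"
    by (intro perm_avg_cong) (simp add: psi_eq_alt_sign[OF ss(2,1)] alt_coeff_permute flip: ps_def)
  finally show ?thesis .
qed

text \<open>Composing with exchanges in \<open>B\<close> makes the linear coefficient at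
  \<open>s\<close> a polynomial on the cube of \<open>B\<close> with the joint coefficients. The
  lower bound for its first moment applies pointwise in \<open>\<pi>\<close>, and the average over
  \<open>B\<close> is absorbed by the average over \<open>\<pi>\<close>.\<close>

lemma sum_fourier_le_slope:
  assumes V: "finite V" "pts I \<subseteq> V" and I: "A \<union> B = I" "A \<inter> B = {}" and s: "s \<in> A" and X: "X \<subseteq> Pow B"
  shows "(\<Sum>T\<in>X. perm_avg V (\<lambda>\<pi>. \<bar>fourier I (\<lambda>S. overlap V k w u (\<pi> \<circ> swp S)) (insert s T)\<bar>))
    \<le> 2 * 3 ^ k * sqrt (card X) * perm_avg V (\<lambda>\<pi>. \<bar>fourier A (\<lambda>S. overlap V k w u (\<pi> \<circ> swp S)) {s}\<bar>)"
proof -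
  define L where "L \<pi> = fourier A (\<lambda>S. overlap V k w u (\<pi> \<circ> swp S)) {s}" for \<pi>
  have sub: "A \<subseteq> I" "B \<subseteq> I" using I by auto
  have fin: "finite A" "finite B" using sub finite_I finite_subset by auto
  have joint: "fourier B (\<lambda>R. L (\<pi> \<circ> swp R)) T = fourier I (\<lambda>S. overlap V k w u (\<pi> \<circ> swp S)) (insert s T)"
    if T: "T \<subseteq> B" for \<pi> T
  proof -
    have "fourier B (\<lambda>R. L (\<pi> \<circ> swp R)) T
        = fourier B (\<lambda>R. fourier A (\<lambda>S. overlap V k w u (\<pi> \<circ> swp (R \<union> S))) {s}) T"
    proof (rule fourier_cong)
      fix R assume "R \<subseteq> B"
      then have "\<pi> \<circ> swp R \<circ> swp S = \<pi> \<circ> swp (R \<union> S)" if "S \<subseteq> A" for S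
        using that I by (subst swp_Un) (auto simp: comp_assoc)
      then show "L (\<pi> \<circ> swp R) = fourier A (\<lambda>S. overlap V k w u (\<pi> \<circ> swp (R \<union> S))) {s}"
        unfolding L_def by (intro fourier_cong) simp
    qed
    also have "\<dots> = fourier (A \<union> B) (\<lambda>S. overlap V k w u (\<pi> \<circ> swp S)) ({s} \<union> T)"
      using fourier_Un[OF fin I(2), of "{s}" T "\<lambda>S. overlap V k w u (\<pi> \<circ> swp S)"] s T by simp
    finally show ?thesis using I by simp
  qed
  have "(\<Sum>T\<in>X. \<bar>fourier B (\<lambda>R. L (\<pi> \<circ> swp R)) T\<bar>)
      \<le> 2 * 3 ^ k * sqrt (card X) * cube_avg B (\<lambda>R. \<bar>L (\<pi> \<circ> swp R)\<bar>)" for \<pi>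
  proof (rule cube_L1_ge_fourier[OF fin(2) _ X])
    fix T assume T: "T \<subseteq> B" "k < card T"
    then have "finite T" using fin finite_subset by auto
    then have "k < card (insert s T)"
      using T(2) card_insert_le[of T s] by linarith
    then show "fourier B (\<lambda>R. L (\<pi> \<circ> swp R)) T = 0"
      unfolding joint[OF T(1)] using T(1) sub s by (intro fourier_overlap_eq_0 V(1)) auto
  qed
  then have "perm_avg V (\<lambda>\<pi>. \<Sum>T\<in>X. \<bar>fourier B (\<lambda>R. L (\<pi> \<circ> swp R)) T\<bar>)
      \<le> perm_avg V (\<lambda>\<pi>. 2 * 3 ^ k * sqrt (card X) * cube_avg B (\<lambda>R. \<bar>L (\<pi> \<circ> swp R)\<bar>))"
    by (intro perm_avg_mono)
  also have "\<dots> = 2 * 3 ^ k * sqrt (card X) * perm_avg V (\<lambda>\<pi>. \<bar>L \<pi>\<bar>)"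
    unfolding perm_avg_mult
    using perm_avg_cube_avg[of B swp V "\<lambda>\<pi>. \<bar>L \<pi>\<bar>"] swp_permutes[OF _ V(2)] sub(2) fin(2)
    by (metis (no_types, lifting) subset_trans)
  finally have "(\<Sum>T\<in>X. perm_avg V (\<lambda>\<pi>. \<bar>fourier B (\<lambda>R. L (\<pi> \<circ> swp R)) T\<bar>))
      \<le> 2 * 3 ^ k * sqrt (card X) * perm_avg V (\<lambda>\<pi>. \<bar>L \<pi>\<bar>)"
    by (simp add: perm_avg_sum)
  moreover have "(\<Sum>T\<in>X. perm_avg V (\<lambda>\<pi>. \<bar>fourier B (\<lambda>R. L (\<pi> \<circ> swp R)) T\<bar>))
      = (\<Sum>T\<in>X. perm_avg V (\<lambda>\<pi>. \<bar>fourier I (\<lambda>S. overlap V k w u (\<pi> \<circ> swp S)) (insert s T)\<bar>))"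
    using joint X by (intro sum.cong refl) auto
  ultimately show ?thesis by (simp add: L_def)
qed

text \<open>Biasing every exchange towards the sign of its linear coefficient, with strength \<open>t\<close>,
  turns the average overlap into a polynomial in \<open>t\<close> that vanishes at 0 and whose slope there is
  the sum of the absolute linear coefficients.\<close>

lemma slope_squared_le:
  assumes K: "slope_constant k K"
    and V: "finite V" "pts I \<subseteq> V" and A: "A \<subseteq> I" and k: "1 \<le> k" and w: "(\<Sum>e\<in>ksubsets V k. w e) = 0"
    and ab: "\<And>\<pi>. \<pi> permutes V \<Longrightarrow> - a \<le> overlap V k w u \<pi> \<and> overlap V k w u \<pi> \<le> b"
  shows "(\<Sum>s\<in>A. perm_avg V (\<lambda>\<pi>. \<bar>fourier A (\<lambda>S. overlap V k w u (\<pi> \<circ> swp S)) {s}\<bar>))\<^sup>2 \<le> K * (a * b)"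
proof -
  have fin: "finite A" using A finite_I finite_subset by auto
  define f where "f \<pi> S = overlap V k w u (\<pi> \<circ> swp S)" for \<pi> S
  define \<sigma> where "\<sigma> \<pi> s = sgn (fourier A (f \<pi>) {s})" for \<pi> s
  define D where "D d = {T \<in> {T \<in> Pow A. card T \<le> k}. card T = d}" for d
  define F where "F \<pi> T = (\<Prod>s\<in>T. \<sigma> \<pi> s) * fourier A (f \<pi>) T" for \<pi> T
  define c where "c d = perm_avg V (\<lambda>\<pi>. \<Sum>T\<in>D d. F \<pi> T)" for d
  have perm: "\<pi> \<circ> swp S permutes V" if "\<pi> permutes V" "S \<subseteq> A" for \<pi> S
    using that A swp_permutes[OF _ V(2)] by (intro permutes_compose) auto
  have expand: "biased_avg A (\<sigma> \<pi>) t (f \<pi>) = (\<Sum>d\<le>k. (\<Sum>T\<in>D d. F \<pi> T) * t ^ d)" for \<pi> t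
  proof -
    have "biased_avg A (\<sigma> \<pi>) t (f \<pi>) = (\<Sum>T\<in>Pow A. t ^ card T * F \<pi> T)"
      by (simp add: biased_avg_fourier[OF fin] F_def mult.assoc)
    also have "\<dots> = (\<Sum>T\<in>{T \<in> Pow A. card T \<le> k}. t ^ card T * F \<pi> T)"
    proof (intro sum.mono_neutral_right ballI)
      fix T assume "T \<in> Pow A - {T \<in> Pow A. card T \<le> k}"
      then have "fourier A (f \<pi>) T = 0"
        unfolding f_def using A by (intro fourier_overlap_eq_0 V(1)) auto
      then show "t ^ card T * F \<pi> T = 0" by (simp add: F_def)
    qed (use fin in auto)
    also have "\<dots> = (\<Sum>d\<le>k. \<Sum>T\<in>D d. t ^ card T * F \<pi> T)"
      unfolding D_def using fin by (intro sum.group[symmetric]) auto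
    also have "\<dots> = (\<Sum>d\<le>k. (\<Sum>T\<in>D d. F \<pi> T) * t ^ d)"
      unfolding sum_distrib_right by (intro sum.cong refl) (simp add: D_def mult.commute)
    finally show ?thesis .
  qed
  have c_poly: "(\<Sum>d\<le>k. c d * t ^ d) = perm_avg V (\<lambda>\<pi>. biased_avg A (\<sigma> \<pi>) t (f \<pi>))" for t
    unfolding expand perm_avg_sum c_def
    by (intro sum.cong refl) (simp add: perm_avg_mult perm_avg_sum mult.commute)
  have "c 0 = 0"
  proof -
    have "card T = 0 \<longleftrightarrow> T = {}" if "T \<subseteq> A" for T
      using finite_subset[OF that fin] by simp
    then have "D 0 = {{}}" by (auto simp: D_def)
    then have "c 0 = perm_avg V (\<lambda>\<pi>. cube_avg A (f \<pi>))"
      by (simp add: c_def F_def fourier_def walsh_def)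
    also have "\<dots> = perm_avg V (overlap V k w u)"
      unfolding f_def using A swp_permutes[OF _ V(2)] fin by (intro perm_avg_cube_avg) auto
    finally show ?thesis using perm_avg_overlap[OF V(1) w] by simp
  qed
  moreover have "- a \<le> (\<Sum>d\<le>k. c d * t ^ d) \<and> (\<Sum>d\<le>k. c d * t ^ d) \<le> b" if t: "\<bar>t\<bar> \<le> 1" for t
  proof -
    have "- a \<le> biased_avg A (\<sigma> \<pi>) t (f \<pi>) \<and> biased_avg A (\<sigma> \<pi>) t (f \<pi>) \<le> b" if "\<pi> permutes V" for \<pi>
      using ab perm[OF that] by (intro biased_avg_bounds fin t) (auto simp: \<sigma>_def f_def abs_sgn_eq)
    then have "perm_avg V (\<lambda>\<pi>. - a) \<le> (\<Sum>d\<le>k. c d * t ^ d)" "(\<Sum>d\<le>k. c d * t ^ d) \<le> perm_avg V (\<lambda>\<pi>. b)"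
      unfolding c_poly by (auto intro!: perm_avg_mono)
    then show ?thesis by (simp add: perm_avg_const[OF V(1)])
  qed
  ultimately have "(c 1)\<^sup>2 \<le> K * (a * b)"
    using K[unfolded slope_constant_def, rule_format, of c a b] by blast
  moreover have "c 1 = (\<Sum>s\<in>A. perm_avg V (\<lambda>\<pi>. \<bar>fourier A (f \<pi>) {s}\<bar>))"
  proof -
    have "D 1 = (\<lambda>s. {s}) ` A" using k by (auto simp: D_def card_1_singleton_iff)
    moreover have "inj_on (\<lambda>s. {s}) A" by (simp add: inj_on_def)
    ultimately have "(\<Sum>T\<in>D 1. F \<pi> T) = (\<Sum>s\<in>A. \<bar>fourier A (f \<pi>) {s}\<bar>)" for \<pi>
      by (simp add: sum.reindex F_def \<sigma>_def abs_sgn mult.commute)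
    then show ?thesis by (simp add: c_def perm_avg_sum)
  qed
  ultimately show ?thesis by (simp add: f_def[abs_def])
qed

text \<open>Replacing each alternating norm by an average over placements costs n^(2j), and the
  square norm of \<open>psi\<close> costs 4^k * n^(k-j); together this is the power k + 3j.
  Hypercontractivity contributes 2 * 3^k and turns the number of sets \<open>T\<close> into its
  square root.\<close>

lemma alt_norm_product_le:
  assumes V: "finite V" "pts I \<subseteq> V" and I: "A \<union> B = I" "A \<inter> B = {}" "A \<noteq> {}"
    and j: "1 \<le> j" "j \<le> k" "k \<le> card V"
  shows "\<exists>\<tau>. \<tau> permutes V \<and>
     card A * sqrt (card B choose (j - 1)) * alt_norm V k j w * alt_norm V k j u
     \<le> 2 * 12 ^ k * real (card V) ^ (k + 3 * j) *
       (\<Sum>s\<in>A. perm_avg V (\<lambda>\<pi>. \<bar>fourier A (\<lambda>S. overlap V k w (\<lambda>e. u (\<tau> ` e)) (\<pi> \<circ> swp S)) {s}\<bar>))"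
proof -
  define N where "N = real (card V)"
  define X where "X = ksubsets B (j - 1)"
  define E where "E = ksubsets V k"
  have sub: "A \<subseteq> I" "B \<subseteq> I" using I by auto
  have fin: "finite A" "finite B" using sub finite_I finite_subset by auto
  have N: "N > 0" using j by (simp add: N_def)
  have cardX: "card X = card B choose (j - 1)" using fin by (simp add: X_def card_ksubsets)
  have sT: "insert s T \<subseteq> I" "card (insert s T) = j" if "s \<in> A" "T \<in> X" for s T
  proof -
    have "T \<subseteq> B" "card T = j - 1" "finite T" "s \<notin> T"
      using that I fin finite_subset by (auto simp: X_def ksubsets_def)
    then show "insert s T \<subseteq> I" "card (insert s T) = j"
      using that sub j(1) by auto
  qed
  define H where "H \<tau> = (\<Sum>s\<in>A. \<Sum>T\<in>X. \<bar>\<Sum>e\<in>E. u (\<tau> ` e) * psi (insert s T) e\<bar>)" for \<tau>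
  \<comment> \<open>The pairs are fixed, so \<open>u\<close> is first moved to a position where its
    alternating sums over them are at least average. This only reparametrises the overlap.\<close>
  obtain \<tau> where \<tau>: "\<tau> permutes V" "perm_avg V H \<le> H \<tau>"
    using perm_avg_le_attained[OF V(1)] by blast
  define Y where "Y = (\<Sum>s\<in>A. perm_avg V (\<lambda>\<pi>. \<bar>fourier A (\<lambda>S. overlap V k w (\<lambda>e. u (\<tau> ` e)) (\<pi> \<circ> swp S)) {s}\<bar>))"
  have "real (card A) * real (card X) * alt_norm V k j u = (\<Sum>s\<in>A. \<Sum>T\<in>X. alt_norm V k j u)"
    by simp
  also have "\<dots> \<le> (\<Sum>s\<in>A. \<Sum>T\<in>X. N ^ (2 * j) * perm_avg V (\<lambda>\<tau>. \<bar>\<Sum>e\<in>E. u (\<tau> ` e) * psi (insert s T) e\<bar>))"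
    unfolding N_def E_def by (intro sum_mono alt_norm_le_perm_avg V sT)
  also have "\<dots> = N ^ (2 * j) * perm_avg V H"
    unfolding H_def perm_avg_sum sum_distrib_left ..
  also have "\<dots> \<le> N ^ (2 * j) * H \<tau>"
    using \<tau>(2) N by (intro mult_left_mono) auto
  finally have 1: "real (card A) * real (card X) * alt_norm V k j u \<le> N ^ (2 * j) * H \<tau>" .
  have summand: "\<bar>\<Sum>e\<in>E. u (\<tau> ` e) * psi (insert s T) e\<bar> * alt_norm V k j w
      \<le> 4 ^ k * N ^ (k + j) * perm_avg V (\<lambda>\<pi>. \<bar>fourier I (\<lambda>S. overlap V k w (\<lambda>e. u (\<tau> ` e)) (\<pi> \<circ> swp S)) (insert s T)\<bar>)"
    if s: "s \<in> A" "T \<in> X" for s T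
  proof -
    let ?P = "perm_avg V (\<lambda>\<pi>. \<bar>fourier I (\<lambda>S. overlap V k w (\<lambda>e. u (\<tau> ` e)) (\<pi> \<circ> swp S)) (insert s T)\<bar>)"
    let ?M = "perm_avg V (\<lambda>\<pi>. \<bar>\<Sum>e\<in>E. w (\<pi> ` e) * psi (insert s T) e\<bar>)"
    let ?U = "\<bar>\<Sum>e\<in>E. u (\<tau> ` e) * psi (insert s T) e\<bar>"
    have "?U * alt_norm V k j w \<le> ?U * (N ^ (2 * j) * ?M)"
      unfolding N_def E_def by (intro mult_left_mono alt_norm_le_perm_avg V sT[OF s]) auto
    also have "\<dots> = N ^ (2 * j) * (?U * ?M)" by simp
    also have "\<dots> \<le> N ^ (2 * j) * ((\<Sum>e\<in>E. (psi (insert s T) e)\<^sup>2) * ?P)"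
      unfolding E_def using N by (intro mult_left_mono perm_avg_fourier_ge V sT[OF s]) auto
    also have "\<dots> \<le> N ^ (2 * j) * ((4 ^ k * N ^ (k - j)) * ?P)"
      unfolding E_def N_def
      by (intro mult_left_mono mult_right_mono sum_psi_squared_le V sT[OF s] j perm_avg_nonneg) auto
    also have "\<dots> = 4 ^ k * N ^ (2 * j + (k - j)) * ?P"
      by (simp add: power_add)
    also have "2 * j + (k - j) = k + j" using j by simp
    finally show ?thesis .
  qed
  have "H \<tau> * alt_norm V k j w = (\<Sum>s\<in>A. \<Sum>T\<in>X. \<bar>\<Sum>e\<in>E. u (\<tau> ` e) * psi (insert s T) e\<bar> * alt_norm V k j w)"
    by (simp add: H_def sum_distrib_right)
  also have "\<dots> \<le> (\<Sum>s\<in>A. \<Sum>T\<in>X. 4 ^ k * N ^ (k + j) * perm_avg V (\<lambda>\<pi>. \<bar>fourier I (\<lambda>S. overlap V k w (\<lambda>e. u (\<tau> ` e)) (\<pi> \<circ> swp S)) (insert s T)\<bar>))"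
    by (intro sum_mono summand)
  also have "\<dots> = 4 ^ k * N ^ (k + j) * (\<Sum>s\<in>A. \<Sum>T\<in>X. perm_avg V (\<lambda>\<pi>. \<bar>fourier I (\<lambda>S. overlap V k w (\<lambda>e. u (\<tau> ` e)) (\<pi> \<circ> swp S)) (insert s T)\<bar>))"
    unfolding sum_distrib_left ..
  also have "\<dots> \<le> 4 ^ k * N ^ (k + j) * (\<Sum>s\<in>A. 2 * 3 ^ k * sqrt (card X) * perm_avg V (\<lambda>\<pi>. \<bar>fourier A (\<lambda>S. overlap V k w (\<lambda>e. u (\<tau> ` e)) (\<pi> \<circ> swp S)) {s}\<bar>))"
    using N by (intro mult_left_mono sum_mono sum_fourier_le_slope[OF V I(1,2)]) (auto simp: X_def ksubsets_def)
  also have "\<dots> = 2 * 12 ^ k * N ^ (k + j) * sqrt (card X) * Y"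
  proof -
    have "(12::real) ^ k = 4 ^ k * 3 ^ k" by (simp flip: power_mult_distrib)
    then show ?thesis unfolding Y_def by (simp add: mult_ac flip: sum_distrib_left)
  qed
  finally have 2: "H \<tau> * alt_norm V k j w \<le> 2 * 12 ^ k * N ^ (k + j) * sqrt (card X) * Y" .
  have "sqrt (card X) * (card A * sqrt (card X) * alt_norm V k j w * alt_norm V k j u)
      = (sqrt (card X) * sqrt (card X)) * card A * alt_norm V k j u * alt_norm V k j w"
    by (simp only: mult_ac)
  also have "\<dots> = real (card A) * real (card X) * alt_norm V k j u * alt_norm V k j w"
    by simp
  also have "\<dots> \<le> N ^ (2 * j) * H \<tau> * alt_norm V k j w"
    using 1 alt_norm_nonneg by (rule mult_right_mono)
  also have "\<dots> \<le> N ^ (2 * j) * (2 * 12 ^ k * N ^ (k + j) * sqrt (card X) * Y)"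
    unfolding mult.assoc[of _ "H \<tau>"] using 2 N by (intro mult_left_mono) auto
  also have "\<dots> = sqrt (card X) * (2 * 12 ^ k * N ^ (k + 3 * j) * Y)"
  proof -
    have "N ^ (k + 3 * j) = N ^ (2 * j) * N ^ (k + j)"
      by (simp add: add.commute flip: power_add)
    then show ?thesis by (simp only: mult_ac)
  qed
  finally have *: "sqrt (card X) * (card A * sqrt (card X) * alt_norm V k j w * alt_norm V k j u)
      \<le> sqrt (card X) * (2 * 12 ^ k * N ^ (k + 3 * j) * Y)" .
  have "Y \<ge> 0" unfolding Y_def by (intro sum_nonneg perm_avg_nonneg) auto
  have "card A * sqrt (card X) * alt_norm V k j w * alt_norm V k j u \<le> 2 * 12 ^ k * N ^ (k + 3 * j) * Y"
  proof (cases "card X = 0")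
    case True
    then show ?thesis using \<open>Y \<ge> 0\<close> N by simp
  next
    case False
    then have "sqrt (card X) > 0" by simp
    then show ?thesis using * by (simp only: mult_le_cancel_left_pos)
  qed
  then show ?thesis using \<tau>(1) by (auto simp: cardX Y_def N_def)
qed

end

section \<open>Discrepancy\<close>

lemma overlap_between_disc:
  assumes V: "finite V" and w: "hweight k w V = 0" and \<sigma>: "\<sigma> permutes V"
  shows "- disc_minus V k w u \<le> overlap V k w u \<sigma> \<and> overlap V k w u \<sigma> \<le> disc_plus V k w u"
proof -
  let ?M = "{hinner V k (hperm \<pi> w) u | \<pi>. \<pi> permutes V}"
  have "?M = (\<lambda>\<pi>. hinner V k (hperm \<pi> w) u) ` {\<pi>. \<pi> permutes V}" by auto
  then have fin: "finite ?M" using finite_permutations[OF V] by simp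
  have "overlap V k w u \<sigma> = hinner V k (hperm (inv \<sigma>) w) u"
    by (simp add: overlap_def hinner_def hperm_def permutes_inv_inv[OF \<sigma>])
  then have "overlap V k w u \<sigma> \<in> ?M"
    using permutes_inv[OF \<sigma>] by blast
  then have "Min ?M \<le> overlap V k w u \<sigma>" "overlap V k w u \<sigma> \<le> Max ?M"
    using fin by auto
  then show ?thesis
    using w by (simp add: disc_plus_def disc_minus_def hdensity_def)
qed

lemma overlap_shift:
  assumes "\<tau> permutes V"
  shows "overlap V k w (\<lambda>e. u (\<tau> ` e)) \<pi> = overlap V k w u (\<pi> \<circ> inv \<tau>)"
  using sum_ksubsets_permute[OF assms, of "\<lambda>e. w ((\<pi> \<circ> inv \<tau>) ` e) * u e" k]
  by (simp add: overlap_def image_comp permutes_inverses[OF assms])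

section \<open>From alternating norms to the lower bound\<close>

text \<open>The term j = 0 is the absolute total weight, hence 0. If the k other terms were all
  below n^k / (C * k * k^k), the norm would be less than (n / k)^k, a lower bound for the binomial
  coefficient.\<close>

lemma large_alt_norm:
  assumes C: "C > 0" "hnorm1 V k w \<le> C * (\<Sum>j\<le>k. alt_norm V k j w / real (card V) ^ j)"
    and V: "finite V" "k \<le> card V" and k: "1 \<le> k"
    and w: "hweight k w V = 0" "hnorm1 V k w = real (card V choose k)"
  shows "\<exists>j\<in>{1..k}. 1 / (C * real k * real k ^ k) * real (card V) ^ (k + j) \<le> alt_norm V k j w"
proof (rule ccontr)
  define N where "N = real (card V)"
  assume "\<not> ?thesis"
  then have small: "alt_norm V k j w < 1 / (C * real k * real k ^ k) * N ^ (k + j)" if "j \<in> {1..k}" for j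
    using that by (auto simp: not_le N_def)
  have N: "N > 0" using k V(2) by (simp add: N_def)
  have "alt_norm V k 0 w = 0"
    using w(1) by (simp add: alt_norm_def alt_coeff_def alt_sign_def hweight_def)
  moreover have "{..k} = insert 0 {1..k}" by auto
  ultimately have "(\<Sum>j\<le>k. alt_norm V k j w / N ^ j) = (\<Sum>j\<in>{1..k}. alt_norm V k j w / N ^ j)"
    by simp
  also have "\<dots> < (\<Sum>j\<in>{1..k}. N ^ k / (C * real k * real k ^ k))"
  proof (rule sum_strict_mono)
    fix j assume j: "j \<in> {1..k}"
    have "alt_norm V k j w / N ^ j < 1 / (C * real k * real k ^ k) * N ^ (k + j) / N ^ j"
      using small[OF j] N by (intro divide_strict_right_mono) auto
    then show "alt_norm V k j w / N ^ j < N ^ k / (C * real k * real k ^ k)"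
      using N by (simp add: power_add)
  qed (use k in auto)
  also have "\<dots> = (N / real k) ^ k / C"
    using k by (simp add: power_divide)
  finally have "C * (\<Sum>j\<le>k. alt_norm V k j w / N ^ j) < C * ((N / real k) ^ k / C)"
    using C(1) by (rule mult_strict_left_mono)
  then have "hnorm1 V k w < (N / real k) ^ k"
    using C by (simp add: N_def)
  moreover have "(N / real k) ^ k \<le> real (card V choose k)"
    using binomial_ge_n_over_k_pow_k[OF V(2), where 'a = real] by (simp add: N_def)
  ultimately show False using w(2) by simp
qed

lemma disc_product_ge:
  fixes w u :: "nat set \<Rightarrow> real"
  assumes K: "slope_constant k K"
    and n: "2 * k \<le> n" and j: "1 \<le> j" "j \<le> k" and w: "hweight k w {1..n} = 0" and \<delta>: "0 \<le> \<delta>"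
    and large: "\<delta> * real n ^ (k + j) \<le> alt_norm {1..n} k j w" "\<delta> * real n ^ (k + j) \<le> alt_norm {1..n} k j u"
  shows "\<delta> ^ 4 / (4 * 144 ^ k * (4 * real k) ^ (k + 1)) * real n ^ (k + 1)
    \<le> K * (disc_plus {1..n} k w u * disc_minus {1..n} k w u)"
proof -
  define V where "V = {1..n}"
  \<comment> \<open>Room for k * r disjoint pairs: r of them are biased and (k - 1) * r are
    exchanged at random. Since n >= 2k, r is at least 1 and at least n / (4k).\<close>
  define r where "r = n div (2 * k)"
  define A where "A = {..<r}"
  define B where "B = {r..<k * r}"
  define N where "N = real n"
  have V: "finite V" "card V = n" by (auto simp: V_def)
  have k: "1 \<le> k" and kn: "k \<le> card V" using j n V(2) by auto
  have r: "1 \<le> r" using n k by (simp add: r_def div_greater_zero_iff Suc_le_eq)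
  have kr: "2 * (k * r) \<le> n" by (simp add: r_def flip: mult.assoc)
  have "n < 2 * k * (r + 1)" using k by (simp add: r_def dividend_less_times_div)
  also have "\<dots> \<le> 4 * k * r" using r k by (simp add: algebra_simps)
  finally have "real n \<le> real (4 * k * r)" by linarith
  then have rN: "N / (4 * real k) \<le> real r" using k by (simp add: N_def field_simps)
  have N1: "N \<ge> 1" using n k by (simp add: N_def)
  define x y :: "nat \<Rightarrow> nat" where "x s = 2 * s + 1" and "y s = 2 * s + 2" for s
  interpret pairing "{..<k * r}" x y
  proof
    have "x s \<noteq> y t" for s t unfolding x_def y_def by presburger
    then show "x ` {..<k * r} \<inter> y ` {..<k * r} = {}" by auto
  qed (auto simp: inj_on_def x_def y_def)
  have pts: "pts {..<k * r} \<subseteq> V"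
    using kr by (auto simp: pts_def V_def x_def y_def)
  have rkr: "r \<le> k * r" using k by simp
  have AB: "A \<union> B = {..<k * r}" "A \<inter> B = {}" "A \<noteq> {}"
  proof -
    show "A \<union> B = {..<k * r}" unfolding A_def B_def using rkr by (rule ivl_disj_un_one)
    show "A \<inter> B = {}" by (auto simp: A_def B_def)
    have "0 \<in> A" using r by (simp add: A_def)
    then show "A \<noteq> {}" by blast
  qed
  obtain \<tau> where \<tau>: "\<tau> permutes V" and
    prod: "card A * sqrt (card B choose (j - 1)) * alt_norm V k j w * alt_norm V k j u
     \<le> 2 * 12 ^ k * real (card V) ^ (k + 3 * j) *
       (\<Sum>s\<in>A. perm_avg V (\<lambda>\<pi>. \<bar>fourier A (\<lambda>S. overlap V k w (\<lambda>e. u (\<tau> ` e)) (\<pi> \<circ> swp S)) {s}\<bar>))"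
    using alt_norm_product_le[OF V(1) pts AB j kn, of w u] by (elim exE conjE) (rule that)
  define Y where "Y = (\<Sum>s\<in>A. perm_avg V (\<lambda>\<pi>. \<bar>fourier A (\<lambda>S. overlap V k w (\<lambda>e. u (\<tau> ` e)) (\<pi> \<circ> swp S)) {s}\<bar>))"
  define q where "q = real (card B choose (j - 1))"
  have Y_le: "Y\<^sup>2 \<le> K * (disc_minus V k w u * disc_plus V k w u)"
    unfolding Y_def
  proof (rule slope_squared_le[OF K V(1) pts _ k])
    show "A \<subseteq> {..<k * r}" using AB by auto
    show "(\<Sum>e\<in>ksubsets V k. w e) = 0" using w by (simp add: hweight_def V_def)
    fix \<pi> assume "\<pi> permutes V"
    then have "\<pi> \<circ> inv \<tau> permutes V" using permutes_compose[OF permutes_inv[OF \<tau>]] by blast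
    then show "- disc_minus V k w u \<le> overlap V k w (\<lambda>e. u (\<tau> ` e)) \<pi>
        \<and> overlap V k w (\<lambda>e. u (\<tau> ` e)) \<pi> \<le> disc_plus V k w u"
      unfolding overlap_shift[OF \<tau>] using w by (intro overlap_between_disc V(1)) (auto simp: V_def)
  qed
  \<comment> \<open>For j = 1 only the empty set is counted, also when k = 1 and \<open>B\<close> is
    empty. Otherwise (k - 1) * r / (j - 1) is at least r.\<close>
  have q: "real r ^ (j - 1) \<le> q"
  proof (cases "j = 1")
    case False
    have "j - 1 \<le> (k - 1) * r" using j r mult_le_mono[of "j - 1" "k - 1" 1 r] by simp
    moreover have "card B = (k - 1) * r" by (simp add: B_def diff_mult_distrib)
    ultimately have "(real ((k - 1) * r) / real (j - 1)) ^ (j - 1) \<le> q"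
      unfolding q_def using binomial_ge_n_over_k_pow_k[where 'a = real] by metis
    moreover have "real r \<le> real ((k - 1) * r) / real (j - 1)"
    proof -
      have "r * (j - 1) \<le> (k - 1) * r"
        using mult_le_mono1[OF diff_le_mono[OF j(2), of 1], of r] by (simp only: mult.commute)
      then have "real (r * (j - 1)) \<le> real ((k - 1) * r)" by (rule of_nat_mono)
      then show ?thesis using False j by (simp add: pos_le_divide_eq)
    qed
    ultimately show ?thesis by (meson order_trans power_mono of_nat_0_le_iff)
  qed (simp add: q_def)
  then have q0: "0 \<le> q" by (simp add: q_def)
  have "N ^ (k + 3 * j) * (real r * sqrt q * \<delta>\<^sup>2 * N ^ (k - j))
      = real r * sqrt q * (\<delta> * N ^ (k + j)) * (\<delta> * N ^ (k + j))"
  proof -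
    have "N ^ (k + 3 * j) * N ^ (k - j) = N ^ (k + j) * N ^ (k + j)"
    proof -
      have "k + 3 * j + (k - j) = (k + j) + (k + j)" using j by simp
      then show ?thesis by (simp only: power_add[symmetric])
    qed
    then show ?thesis by (simp add: power2_eq_square mult_ac)
  qed
  also have "\<dots> \<le> real r * sqrt q * alt_norm V k j w * alt_norm V k j u"
    using large \<delta> q0 N1 alt_norm_nonneg unfolding N_def V_def
    by (intro mult_mono mult_left_mono mult_nonneg_nonneg) auto
  also have "\<dots> \<le> N ^ (k + 3 * j) * (2 * 12 ^ k * Y)"
    using prod by (simp add: A_def q_def Y_def N_def V(2) mult_ac)
  finally have "real r * sqrt q * \<delta>\<^sup>2 * N ^ (k - j) \<le> 2 * 12 ^ k * Y"
    using N1 by (simp only: mult_le_cancel_left_pos zero_less_power)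
  then have "(real r * sqrt q * \<delta>\<^sup>2 * N ^ (k - j))\<^sup>2 \<le> (2 * 12 ^ k * Y)\<^sup>2"
    using q0 N1 by (intro power_mono) auto
  also have "\<dots> = 4 * 144 ^ k * Y\<^sup>2"
  proof -
    have "(12 ^ k)\<^sup>2 = (144::real) ^ k" by (simp add: power2_eq_square flip: power_mult_distrib)
    then show ?thesis by (simp add: power_mult_distrib)
  qed
  also have "(real r * sqrt q * \<delta>\<^sup>2 * N ^ (k - j))\<^sup>2 = \<delta> ^ 4 * ((real r)\<^sup>2 * q * N ^ (2 * (k - j)))"
    using q0 by (simp add: power_mult_distrib mult_ac flip: power_mult)
  finally have lower: "\<delta> ^ 4 * ((real r)\<^sup>2 * q * N ^ (2 * (k - j))) \<le> 4 * 144 ^ k * Y\<^sup>2" .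
  \<comment> \<open>The exponent j + 1 + 2 (k - j) is 2k - j + 1, at least k + 1 with equality for j
    = k.\<close>
  have "N ^ (k + 1) / (4 * real k) ^ (k + 1) \<le> N ^ (j + 1 + 2 * (k - j)) / (4 * real k) ^ (j + 1)"
    using j k N1 by (intro frac_le power_increasing) auto
  also have "\<dots> = (N / (4 * real k)) ^ (j + 1) * N ^ (2 * (k - j))"
    by (simp add: power_divide power_add)
  also have "\<dots> \<le> real r ^ (j + 1) * N ^ (2 * (k - j))"
    using rN N1 by (intro mult_right_mono power_mono) auto
  also have "real r ^ (j + 1) = (real r)\<^sup>2 * real r ^ (j - 1)"
    using j by (simp flip: power_add)
  also have "\<dots> * N ^ (2 * (k - j)) \<le> (real r)\<^sup>2 * q * N ^ (2 * (k - j))"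
    using q N1 by (intro mult_right_mono mult_left_mono) auto
  finally have "\<delta> ^ 4 * (N ^ (k + 1) / (4 * real k) ^ (k + 1)) \<le> 4 * 144 ^ k * Y\<^sup>2"
    using lower \<delta> by (meson mult_left_mono order_trans zero_le_power)
  then have "\<delta> ^ 4 * (N ^ (k + 1) / (4 * real k) ^ (k + 1)) / (4 * 144 ^ k) \<le> Y\<^sup>2"
    by (subst pos_divide_le_eq) (simp_all only: mult.commute[of "Y\<^sup>2"], simp)
  moreover have "d / (D * E) * M = d * (M / E) / D" for d D E M :: real
    by simp
  ultimately have "\<delta> ^ 4 / (4 * 144 ^ k * (4 * real k) ^ (k + 1)) * N ^ (k + 1) \<le> Y\<^sup>2"
    by (simp only:)
  also have "\<dots> \<le> K * (disc_plus V k w u * disc_minus V k w u)"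
    using Y_le by (simp add: mult.commute)
  finally show ?thesis by (simp add: N_def V_def)
qed

theorem theorem1p2:
  fixes k :: nat
  assumes "k \<ge> 1"
  shows "\<exists>c c' :: real. c > 0 \<and> c' > 0 \<and>
    (\<forall>(n::nat) (w :: nat \<Rightarrow> nat set \<Rightarrow> real).
       n \<ge> 2 * k \<longrightarrow>
       (\<forall>i\<in>{1..k+1}. hweight k (w i) {1..n} = 0 \<and>
                      hnorm1 {1..n} k (w i) = real (n choose k)) \<longrightarrow>
       (\<exists>i\<in>{1..k+1}. \<exists>j\<in>{1..k+1}. i \<noteq> j \<and>
          disc_plus {1..n} k (w i) (w j) * disc_minus {1..n} k (w i) (w j)
            \<ge> c * real n ^ (k + 1))
       \<and> (\<exists>i\<in>{1..k+1}. \<exists>j\<in>{1..k+1}. i < j \<and>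
          disc {1..n} k (w i) (w j) \<ge> c' * real n powr ((real k + 1) / 2)))"
proof -
  obtain K where "K > 0" and K: "slope_constant k K"
    using ex_slope_constant[OF assms] by blast
  obtain C where "C > 0" and C': "\<forall>(V :: nat set) w. finite V \<longrightarrow> 2 * k \<le> card V \<longrightarrow>
     hnorm1 V k w \<le> C * (\<Sum>j\<le>k. alt_norm V k j w / real (card V) ^ j)"
    using hnorm1_le_alt_norms[of k] by (elim exE conjE) (rule that)
  note C = C'[rule_format]
  define \<delta> where "\<delta> = 1 / (C * real k * real k ^ k)"
  have \<delta>: "\<delta> > 0" using \<open>C > 0\<close> assms by (simp add: \<delta>_def)
  define c where "c = \<delta> ^ 4 / (4 * 144 ^ k * (4 * real k) ^ (k + 1)) / K"
  have c: "c > 0" using \<delta> \<open>K > 0\<close> assms by (simp add: c_def)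
  have "\<exists>i\<in>{1..k+1}. \<exists>j\<in>{1..k+1}. i < j \<and>
      c * real n ^ (k + 1) \<le> disc_plus {1..n} k (w i) (w j) * disc_minus {1..n} k (w i) (w j) \<and>
      sqrt c * real n powr ((real k + 1) / 2) \<le> disc {1..n} k (w i) (w j)"
    if n: "n \<ge> 2 * k" and w: "\<And>i. i \<in> {1..k+1} \<Longrightarrow> hweight k (w i) {1..n} = 0"
      "\<And>i. i \<in> {1..k+1} \<Longrightarrow> hnorm1 {1..n} k (w i) = real (n choose k)"
    for n and w :: "nat \<Rightarrow> nat set \<Rightarrow> real"
  proof -
    have "\<exists>j\<in>{1..k}. \<delta> * real n ^ (k + j) \<le> alt_norm {1..n} k j (w i)" if "i \<in> {1..k+1}" for i
      using large_alt_norm[OF \<open>C > 0\<close> C, of "{1..n}" "w i"] w[OF that] n assms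
      by (simp add: \<delta>_def)
    then obtain J where J: "\<And>i. i \<in> {1..k+1} \<Longrightarrow> J i \<in> {1..k}"
      and large: "\<And>i. i \<in> {1..k+1} \<Longrightarrow> \<delta> * real n ^ (k + J i) \<le> alt_norm {1..n} k (J i) (w i)"
      by metis
    have "\<not> inj_on J {1..k+1}"
    proof
      assume "inj_on J {1..k+1}"
      then have "card {1..k+1} \<le> card {1..k}"
        by (rule card_inj_on_le) (use J in auto)
      then show False by simp
    qed
    then obtain i i' where i: "i \<in> {1..k+1}" "i' \<in> {1..k+1}" "i < i'" "J i = J i'"
      unfolding inj_on_def by (metis linorder_neqE_nat)
    let ?p = "disc_plus {1..n} k (w i) (w i')" and ?m = "disc_minus {1..n} k (w i) (w i')"
    have "K * (c * real n ^ (k + 1)) \<le> K * (?p * ?m)"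
      using disc_product_ge[OF K n _ _ w(1)[OF i(1)] _ large[OF i(1)], of "w i'"] large[OF i(2)] J[OF i(1)]
        i(4) \<delta> \<open>K > 0\<close> by (simp add: c_def)
    then have prod: "c * real n ^ (k + 1) \<le> ?p * ?m"
      using \<open>K > 0\<close> by simp
    \<comment> \<open>The overlap at the identity lies between -?m and ?p, so the two discrepancies
      are not both negative. If one is negative, their product is at most 0; otherwise it is at most
      the square of the maximum.\<close>
    have "- ?m \<le> ?p"
      using overlap_between_disc[OF _ w(1)[OF i(1)] permutes_id, of "w i'"] by force
    then have max: "0 \<le> max ?p ?m" by linarith
    have "?p * ?m \<le> (max ?p ?m)\<^sup>2"
    proof (cases "0 \<le> ?p \<and> 0 \<le> ?m")
      case True
      then show ?thesis unfolding power2_eq_square by (intro mult_mono) auto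
    next
      case False
      then have "?p * ?m \<le> 0"
        using \<open>- ?m \<le> ?p\<close> by (auto simp: mult_le_0_iff)
      then show ?thesis by (meson order_trans zero_le_power2)
    qed
    then have "sqrt (c * real n ^ (k + 1)) \<le> max ?p ?m"
      using prod max by (intro real_le_lsqrt) auto
    moreover have "sqrt (real n ^ (k + 1)) = real n powr ((real k + 1) / 2)"
    proof -
      have "real n > 0" using n assms by simp
      then have "real n ^ (k + 1) = real n powr (real k + 1)"
        using powr_realpow[of "real n" "k + 1"] by (simp add: add.commute)
      then have "sqrt (real n ^ (k + 1)) = (real n powr (real k + 1)) powr (1 / 2)"
        by (simp only: powr_half_sqrt[OF powr_ge_zero])
      then show ?thesis by (simp add: powr_powr)
    qed
    ultimately have "sqrt c * real n powr ((real k + 1) / 2) \<le> disc {1..n} k (w i) (w i')"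
      by (simp add: real_sqrt_mult disc_def)
    then show ?thesis using prod i by blast
  qed
  then have main: "\<exists>i\<in>{1..k+1}. \<exists>j\<in>{1..k+1}. i < j \<and>
      c * real n ^ (k + 1) \<le> disc_plus {1..n} k (w i) (w j) * disc_minus {1..n} k (w i) (w j) \<and>
      sqrt c * real n powr ((real k + 1) / 2) \<le> disc {1..n} k (w i) (w j)"
    if "n \<ge> 2 * k" "\<forall>i\<in>{1..k+1}. hweight k (w i) {1..n} = 0 \<and> hnorm1 {1..n} k (w i) = real (n choose k)"
    for n and w :: "nat \<Rightarrow> nat set \<Rightarrow> real"
    using that by blast
  show ?thesis
  proof (rule exI[of _ c], rule exI[of _ "sqrt c"], intro conjI allI impI)
    fix n and w :: "nat \<Rightarrow> nat set \<Rightarrow> real"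
    assume "n \<ge> 2 * k" "\<forall>i\<in>{1..k+1}. hweight k (w i) {1..n} = 0 \<and> hnorm1 {1..n} k (w i) = real (n choose k)"
    then obtain i j where ij: "i \<in> {1..k+1}" "j \<in> {1..k+1}" "i < j"
      "c * real n ^ (k + 1) \<le> disc_plus {1..n} k (w i) (w j) * disc_minus {1..n} k (w i) (w j)"
      "sqrt c * real n powr ((real k + 1) / 2) \<le> disc {1..n} k (w i) (w j)"
      using main by blast
    then show "\<exists>i\<in>{1..k+1}. \<exists>j\<in>{1..k+1}. i \<noteq> j \<and>
        c * real n ^ (k + 1) \<le> disc_plus {1..n} k (w i) (w j) * disc_minus {1..n} k (w i) (w j)"
      by (metis less_irrefl)
    show "\<exists>i\<in>{1..k+1}. \<exists>j\<in>{1..k+1}. i < j \<and>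
        sqrt c * real n powr ((real k + 1) / 2) \<le> disc {1..n} k (w i) (w j)"
      using ij by blast
  qed (use c in auto)
qed

end
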